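(* Let $d\ge 1$, $p>1$, let $J$ be an admissible interaction kernel on $\mathbb{Z}^d$ with tail index $\alpha\in(0,\infty]$, and let $\alpha'=\alpha/2$ if $\alpha\in(0,2)$ and $\alpha'=1$ if $\alpha\in[2,\infty]$. If $p<1+\frac{4\alpha'}{d}$, then $K=0$. Consequently $\nu_0=0$, and $I_\nu$ has a minimizer for every $\nu>0$.
   Context: $|n|$ denotes the $l^1$ norm of $n\in\mathbb{Z}^d$, and $S_k=\{n\in\mathbb{Z}^d:|n|=k\}$. An admissible interaction kernel with tail index $\alpha\in(0,\infty]$ is a function $J:\mathbb{Z}^d\to[0,\infty)$ with $J_0=0$, $J_n=J_{-n}$ for all $n$, and $\overline{J}:=\sum_m J_m<\infty$, for which there is an envelope $\eta:\mathbb{N}\to[0,\infty)$ such that: if $\alpha<\infty$, there exist $0<C_1<C_2$ and $k_0\in\mathbb{N}$ with $C_1\le k^{d+\alpha}\eta(k)\le C_2$ for all $k\ge k_0$; if $\alpha=\infty$, $\lim_{k\to\infty}k^{d+\beta}\eta(k)=0$ for every $\beta<\infty$; and moreover (I) there exist $R,c_\pm>0$ such that $J_n\le c_+\eta(|n|)$ whenever $|n|\ge R$, and $\sum_{m\in S_k}J_m\ge c_-k^{d-1}\eta(k)$ whenever $k\ge R$; (II) $\min_{m\in S_1}J_m>0$. For $u\in l^2(\mathbb{Z}^d)$ (complex-valued) let $(Lu)_n=\sum_{m\ne n}J_{n-m}(u_n-u_m)$, $M[u]=\|u\|_{l^2}^2$, and $H[u]=\frac12\langle Lu,u\rangle-\frac{1}{p+1}\|u\|_{l^{p+1}}^{p+1}$.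 For $\nu>0$ let $I_\nu=\inf\{H[q]:q\in l^2(\mathbb{Z}^d),\ M[q]=\nu\}$; a minimizer of $I_\nu$ is a $q$ with $M[q]=\nu$ and $H[q]=I_\nu$. Define $$K=\inf_{u\in l^2(\mathbb{Z}^d)\setminus\{0\}}\frac{\|u\|_{l^2}^{p-1}\langle Lu,u\rangle}{\|u\|_{l^{p+1}}^{p+1}}\ge 0,\qquad \nu_0=\Big(\frac{p+1}{2}K\Big)^{\frac{2}{p-1}}.$$ Equivalently, $\nu_0$ is the supremum of $\nu>0$ (taken as $0$ if there are none) such that $\|q\|_{l^{p+1}}^{p+1}\le\frac{p+1}{2}\nu^{-\frac{p-1}{2}}\|q\|_{l^2}^{p-1}\langle Lq,q\rangle$ for all $q\in l^2(\mathbb{Z}^d)$. *)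

theory Defs
  imports "HOL-Analysis.Analysis"
begin

text \<open>The lattice is the type \<^typ>\<open>int ^ 'd\<close>, with dimension \<^term>\<open>CARD('d)\<close>.\<close>

definition l1_norm :: "int ^ 'd \<Rightarrow> nat" where
  "l1_norm n = (\<Sum>i\<in>UNIV. nat \<bar>n $ i\<bar>)"

definition l1_sphere :: "nat \<Rightarrow> (int ^ 'd) set" where
  "l1_sphere k = {n. l1_norm n = k}"

lemma finite_l1_sphere: "finite (l1_sphere k :: (int ^ 'd) set)"
proof -
  have bound: "n $ i \<in> {- int (l1_norm n)..int (l1_norm n)}" for n :: "int ^ 'd" and i
  proof -
    have "nat \<bar>n $ i\<bar> \<le> l1_norm n"
      unfolding l1_norm_def by (rule member_le_sum) auto
    then show ?thesis by auto
  qed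
  have "vec_nth ` (l1_sphere k :: (int ^ 'd) set) \<subseteq> PiE UNIV (\<lambda>_. {- int k..int k})"
    using bound by (auto simp: l1_sphere_def PiE_def simp del: atLeastAtMost_iff)
  moreover have "finite (PiE (UNIV :: 'd set) (\<lambda>_. {- int k..int k}))"
    by (rule finite_PiE) auto
  ultimately have "finite (vec_nth ` (l1_sphere k :: (int ^ 'd) set))"
    by (rule finite_subset)
  then show ?thesis
    by (rule finite_imageD) (simp add: inj_on_def vec_nth_inject)
qed

text \<open>The tail index is an extended real, so that the value \<open>\<infinity>\<close> is allowed. In the case
  \<open>\<alpha> < \<infinity>\<close> the threshold \<open>k0\<close> is necessarily positive, since \<open>0 powr x = 0\<close>.\<close>

definition envelope :: "nat \<Rightarrow> ereal \<Rightarrow> (nat \<Rightarrow> real) \<Rightarrow> bool" where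
  "envelope d \<alpha> \<eta> \<longleftrightarrow>
     (\<forall>k. 0 \<le> \<eta> k) \<and>
     (\<alpha> < \<infinity> \<longrightarrow>
        (\<exists>C1 C2 :: real. \<exists>k0 :: nat. 0 < C1 \<and> C1 < C2 \<and>
           (\<forall>k\<ge>k0. C1 \<le> real k powr (real d + real_of_ereal \<alpha>) * \<eta> k \<and>
                   real k powr (real d + real_of_ereal \<alpha>) * \<eta> k \<le> C2))) \<and>
     (\<alpha> = \<infinity> \<longrightarrow>
        (\<forall>\<beta> :: real. (\<lambda>k. real k powr (real d + \<beta>) * \<eta> k) \<longlonglongrightarrow> 0))"

definition admissible_kernel :: "ereal \<Rightarrow> (int ^ 'd \<Rightarrow> real) \<Rightarrow> bool" where
  "admissible_kernel \<alpha> J \<longleftrightarrow>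
     0 < \<alpha> \<and>
     (\<forall>n. 0 \<le> J n) \<and> J 0 = 0 \<and> (\<forall>n. J n = J (- n)) \<and> J summable_on UNIV \<and>
     (\<exists>\<eta>. envelope CARD('d) \<alpha> \<eta> \<and>
        (\<exists>R c_plus c_minus :: real. 0 < R \<and> 0 < c_plus \<and> 0 < c_minus \<and>
           (\<forall>n. R \<le> real (l1_norm n) \<longrightarrow> J n \<le> c_plus * \<eta> (l1_norm n)) \<and>
           (\<forall>k. R \<le> real k \<longrightarrow>
              c_minus * real k ^ (CARD('d) - 1) * \<eta> k \<le> (\<Sum>m\<in>l1_sphere k. J m)))) \<and>
     0 < (MIN m\<in>l1_sphere 1. J m)"

definition lp_space :: "real \<Rightarrow> (int ^ 'd \<Rightarrow> complex) set" where
  "lp_space r = {u. (\<lambda>n. norm (u n) powr r) summable_on UNIV}"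

definition lp_norm :: "real \<Rightarrow> (int ^ 'd \<Rightarrow> complex) \<Rightarrow> real" where
  "lp_norm r u = (\<Sum>\<^sub>\<infinity>n. norm (u n) powr r) powr (1 / r)"

definition l2_inner :: "(int ^ 'd \<Rightarrow> complex) \<Rightarrow> (int ^ 'd \<Rightarrow> complex) \<Rightarrow> complex" where
  "l2_inner u v = (\<Sum>\<^sub>\<infinity>n. u n * cnj (v n))"

definition lattice_op :: "(int ^ 'd \<Rightarrow> real) \<Rightarrow> (int ^ 'd \<Rightarrow> complex) \<Rightarrow> int ^ 'd \<Rightarrow> complex" where
  "lattice_op J u n = (\<Sum>\<^sub>\<infinity>m\<in>UNIV - {n}. complex_of_real (J (n - m)) * (u n - u m))"

text \<open>For an admissible kernel the operator is bounded, self-adjoint and nonnegative on \<open>l\<^sup>2\<close>,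
  so the complex number \<open>\<langle>Lu,u\<rangle>\<close> is real; taking its real part only changes the type.\<close>

definition lattice_form :: "(int ^ 'd \<Rightarrow> real) \<Rightarrow> (int ^ 'd \<Rightarrow> complex) \<Rightarrow> real" where
  "lattice_form J u = Re (l2_inner (lattice_op J u) u)"

definition mass :: "(int ^ 'd \<Rightarrow> complex) \<Rightarrow> real" where
  "mass u = (lp_norm 2 u)\<^sup>2"

definition hamiltonian :: "real \<Rightarrow> (int ^ 'd \<Rightarrow> real) \<Rightarrow> (int ^ 'd \<Rightarrow> complex) \<Rightarrow> real" where
  "hamiltonian p J u = lattice_form J u / 2 - lp_norm (p + 1) u powr (p + 1) / (p + 1)"

text \<open>Both infima below are infima in \<^typ>\<open>real\<close> of nonempty sets that are bounded below
  (for admissible \<open>J\<close>, \<open>p > 1\<close> and \<open>\<nu> > 0\<close>), because \<open>\<langle>Lu,u\<rangle> \<ge> 0\<close> and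
  \<open>\<parallel>u\<parallel>\<close> in \<open>l\<^sup>p\<^sup>+\<^sup>1\<close> is at most \<open>\<parallel>u\<parallel>\<close> in \<open>l\<^sup>2\<close>.\<close>

definition ground_energy :: "real \<Rightarrow> (int ^ 'd \<Rightarrow> real) \<Rightarrow> real \<Rightarrow> real" where
  "ground_energy p J \<nu> = (INF q\<in>{q \<in> lp_space 2. mass q = \<nu>}. hamiltonian p J q)"

definition is_minimizer ::
  "real \<Rightarrow> (int ^ 'd \<Rightarrow> real) \<Rightarrow> real \<Rightarrow> (int ^ 'd \<Rightarrow> complex) \<Rightarrow> bool" where
  "is_minimizer p J \<nu> q \<longleftrightarrow>
     q \<in> lp_space 2 \<and> mass q = \<nu> \<and> hamiltonian p J q = ground_energy p J \<nu>"

definition GN_const :: "real \<Rightarrow> (int ^ 'd \<Rightarrow> real) \<Rightarrow> real" where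
  "GN_const p J =
     (INF u\<in>lp_space 2 - {\<lambda>_. 0}.
        lp_norm 2 u powr (p - 1) * lattice_form J u / lp_norm (p + 1) u powr (p + 1))"

definition threshold_mass :: "real \<Rightarrow> (int ^ 'd \<Rightarrow> real) \<Rightarrow> real" where
  "threshold_mass p J = ((p + 1) / 2 * GN_const p J) powr (2 / (p - 1))"

definition reduced_index :: "ereal \<Rightarrow> real" where
  "reduced_index \<alpha> = (if \<alpha> < 2 then real_of_ereal \<alpha> / 2 else 1)"

end

theory Submission
  imports Defs "HOL-Complex_Analysis.Great_Picard"
begin

text \<open>Let \<open>d\<close> be the dimension. An admissible kernel has finite moments \<open>\<Sum>\<^sub>m J\<^sub>m |m|\<^sup>s\<close> for \<open>s < \<alpha>\<close>. If also
  \<open>s \<le> 2\<close>, the tent of height 1 and radius \<open>N\<close> has energy \<open>O(N\<^bsup>d-s\<^esup>)\<close>, whereas its mass and its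
  \<open>l\<^bsup>p+1\<^esup>\<close> sum are of order \<open>N\<^sup>d\<close>; its quotient is therefore \<open>O(N\<^bsup>d(p-1)/2-s\<^esup>)\<close>, and the hypothesis
  on \<open>p\<close> leaves room for an \<open>s\<close> with negative exponent. Hence \<open>K = 0\<close>, so \<open>I\<^sub>\<nu> < 0\<close> for every \<open>\<nu>\<close>,
  and minimizing sequences are compact up to translation.\<close>

subsection \<open>Summation and elementary inequalities\<close>

text \<open>The cap \<open>s \<le> 2\<close> comes from the tent: its increments over a distance r
  are at most min(1, r/N), and min(1, x)^2 is at most x^s for 0 < s and \<open>s \<le> 2\<close>.
  Moments are available only for s strictly below \<alpha>. The two limits combine to min(\<alpha>,
  2), twice the reduced index, and the hypothesis on p says exactly that d(p-1)/2 lies below it. A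
  function u rescaled to mass \<nu> has negative energy exactly when its quotient is below 2/(p+1)
  times \<nu>^((p-1)/2), so a vanishing infimum serves every \<nu> at once. The obstacle to
  compactness is that bounded sequences converge only pointwise, so mass may escape. Since the sup
  norm is controlled by the mass, the escaping part can be split off directly: in the mass, the
  quadratic form and the l^(p+1) sum alike, the splitting error is dominated by a sum of products of
  a fixed square-summable function with a bounded, pointwise null sequence.\<close>

lemma has_sum_convolution:
  fixes K w :: "'a::ab_group_add \<Rightarrow> real"
  assumes K: "K summable_on UNIV" "\<And>n. 0 \<le> K n" and w: "w summable_on UNIV" "\<And>n. 0 \<le> w n"
  shows has_sum_convolution1:
      "((\<lambda>(n, m). K (n - m) * w n) has_sum (infsum K UNIV * infsum w UNIV)) UNIV"
    and has_sum_convolution2: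
      "((\<lambda>(n, m). K (n - m) * w m) has_sum (infsum K UNIV * infsum w UNIV)) UNIV"
proof -
  have 1: "((\<lambda>m. K n * w m) has_sum (K n * infsum w UNIV)) UNIV" for n
    using w by (intro has_sum_cmult_right) auto
  have 2: "((\<lambda>n. K n * infsum w UNIV) has_sum (infsum K UNIV * infsum w UNIV)) UNIV"
    using K by (intro has_sum_cmult_left) auto
  have "(\<lambda>(n, m). K n * w m) summable_on Sigma UNIV (\<lambda>_. UNIV)"
    using 1 2 K w by (intro summable_on_SigmaI[where g = "\<lambda>n. K n * infsum w UNIV"])
      (auto simp: summable_on_def)
  from has_sum_SigmaI[OF _ 2 this] 1
  have *: "((\<lambda>(n, m). K n * w m) has_sum (infsum K UNIV * infsum w UNIV)) UNIV"
    by simp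
  \<comment> \<open>Changing variables to the difference and one endpoint turns each double sum into
    a product of two single sums.\<close>
  have bij1: "bij_betw (\<lambda>(n, m). (n - m, n)) UNIV (UNIV :: ('a \<times> 'a) set)"
    by (rule bij_betwI[where g = "\<lambda>(a, b). (b, b - a)"]) auto
  have bij2: "bij_betw (\<lambda>(n, m). (n - m, m)) UNIV (UNIV :: ('a \<times> 'a) set)"
    by (rule bij_betwI[where g = "\<lambda>(a, b). (a + b, b)"]) auto
  show "((\<lambda>(n, m). K (n - m) * w n) has_sum (infsum K UNIV * infsum w UNIV)) UNIV"
    using has_sum_reindex_bij_betw[OF bij1, of "\<lambda>(n, m). K n * w m"] *
    by (simp add: case_prod_unfold)
  show "((\<lambda>(n, m). K (n - m) * w m) has_sum (infsum K UNIV * infsum w UNIV)) UNIV"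
    using has_sum_reindex_bij_betw[OF bij2, of "\<lambda>(n, m). K n * w m"] *
    by (simp add: case_prod_unfold)
qed

lemma summable_on_mult_squares:
  fixes g h :: "'a \<Rightarrow> real"
  assumes "(\<lambda>x. (g x)\<^sup>2) summable_on A" "(\<lambda>x. (h x)\<^sup>2) summable_on A"
  shows "(\<lambda>x. \<bar>g x * h x\<bar>) summable_on A"
  using abs_summable_product[of g A h] assms
  by (simp add: power2_eq_square)

text \<open>Weak convergence to 0 with absolute values inside the sum. Outside a finite set the
  squares of \<open>g\<close> have a small sum and Young's inequality applies; on the finite set
  pointwise convergence suffices.\<close>

lemma cross_sum_tendsto_0:
  fixes g :: "'a \<Rightarrow> real" and r :: "nat \<Rightarrow> 'a \<Rightarrow> real"
  assumes g: "(\<lambda>x. (g x)\<^sup>2) summable_on UNIV"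
    and r: "\<And>k. (\<lambda>x. (r k x)\<^sup>2) summable_on UNIV"
    and C: "\<And>k. (\<Sum>\<^sub>\<infinity>x. (r k x)\<^sup>2) \<le> C"
    and lim: "\<And>x. (\<lambda>k. r k x) \<longlonglongrightarrow> 0"
  shows "(\<lambda>k. \<Sum>\<^sub>\<infinity>x. \<bar>g x * r k x\<bar>) \<longlonglongrightarrow> 0"
proof (rule LIMSEQ_I)
  fix \<epsilon> :: real assume "\<epsilon> > 0"
  \<comment> \<open>\<open>max C 1\<close> secures positivity. With the Young weight
    \<open>t\<close> the part of \<open>r k\<close> costs at most
    \<open>D / (2 * t) = \<epsilon> / 2\<close> and the tail of \<open>g\<close> at most
    \<open>\<epsilon> / 4\<close>, which leaves \<open>\<epsilon> / 4\<close> for the finite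
    set.\<close>
  define D where "D = max C 1"
  define t where "t = D / \<epsilon>"
  have D: "D \<ge> 1" "\<And>k. (\<Sum>\<^sub>\<infinity>x. (r k x)\<^sup>2) \<le> D"
    using C by (auto simp: D_def intro: le_max_iff_disj[THEN iffD2])
  have t: "t > 0" using \<open>\<epsilon> > 0\<close> D by (simp add: t_def)
  obtain F where F: "finite F" "dist (sum (\<lambda>x. (g x)\<^sup>2) F) (\<Sum>\<^sub>\<infinity>x. (g x)\<^sup>2) \<le> \<epsilon> / (2 * t)"
    using infsum_finite_approximation[OF g, of "\<epsilon> / (2 * t)"] \<open>\<epsilon> > 0\<close> t by auto
  have sub: "f summable_on UNIV \<Longrightarrow> f summable_on S" for f :: "'a \<Rightarrow> real" and S
    by (erule summable_on_subset_banach) auto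
  have split: "infsum f UNIV = sum f F + infsum f (- F)" if "f summable_on UNIV" for f :: "'a \<Rightarrow> real"
    using infsum_Un_disjoint[of f F "- F"] sub[OF that] F(1) by (simp add: Un_commute Compl_partition)
  have tail_g: "(\<Sum>\<^sub>\<infinity>x\<in>-F. (g x)\<^sup>2) \<le> \<epsilon> / (2 * t)"
    using F(2) split[OF g] by (auto simp: dist_real_def abs_le_iff)
  have tail: "(\<Sum>\<^sub>\<infinity>x\<in>-F. \<bar>g x * r k x\<bar>) \<le> 3 / 4 * \<epsilon>" for k
  proof -
    have le: "(\<Sum>\<^sub>\<infinity>x\<in>-F. (r k x)\<^sup>2) \<le> D"
      using split[OF r, of k] D(2)[of k] sum_nonneg[of F "\<lambda>x. (r k x)\<^sup>2"] by simp
    have "(\<Sum>\<^sub>\<infinity>x\<in>-F. \<bar>g x * r k x\<bar>) \<le> (\<Sum>\<^sub>\<infinity>x\<in>-F. t / 2 * (g x)\<^sup>2 + 1 / (2 * t) * (r k x)\<^sup>2)"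
    proof (rule infsum_mono)
      show "(\<lambda>x. \<bar>g x * r k x\<bar>) summable_on - F"
        using summable_on_mult_squares[OF sub[OF g] sub[OF r[of k]]] by simp
      show "(\<lambda>x. t / 2 * (g x)\<^sup>2 + 1 / (2 * t) * (r k x)\<^sup>2) summable_on - F"
        by (intro summable_on_add summable_on_cmult_right sub[OF g] sub[OF r])
      fix x
      have "0 \<le> (t * \<bar>g x\<bar> - \<bar>r k x\<bar>)\<^sup>2" by simp
      then show "\<bar>g x * r k x\<bar> \<le> t / 2 * (g x)\<^sup>2 + 1 / (2 * t) * (r k x)\<^sup>2"
        using t by (simp add: power2_diff field_simps abs_mult power2_eq_square power_mult_distrib)
    qed
    also have "\<dots> = t / 2 * (\<Sum>\<^sub>\<infinity>x\<in>-F. (g x)\<^sup>2) + 1 / (2 * t) * (\<Sum>\<^sub>\<infinity>x\<in>-F. (r k x)\<^sup>2)"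
      by (simp only: infsum_add[OF summable_on_cmult_right[OF sub[OF g]]
            summable_on_cmult_right[OF sub[OF r]]] infsum_cmult_right')
    also have "\<dots> \<le> t / 2 * (\<epsilon> / (2 * t)) + 1 / (2 * t) * D"
      using t tail_g le by (intro add_mono mult_left_mono) auto
    also have "\<dots> = 3 / 4 * \<epsilon>"
      using t \<open>\<epsilon> > 0\<close> D by (simp add: t_def field_simps)
    finally show ?thesis .
  qed
  have "(\<lambda>k. \<Sum>x\<in>F. \<bar>g x * r k x\<bar>) \<longlonglongrightarrow> (\<Sum>x\<in>F. \<bar>g x * 0\<bar>)"
    by (intro tendsto_intros lim)
  then have "(\<lambda>k. \<Sum>x\<in>F. \<bar>g x * r k x\<bar>) \<longlonglongrightarrow> 0" by simp
  from order_tendstoD(2)[OF this, of "\<epsilon> / 4"] \<open>\<epsilon> > 0\<close>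
  obtain N where N: "\<And>k. k \<ge> N \<Longrightarrow> (\<Sum>x\<in>F. \<bar>g x * r k x\<bar>) < \<epsilon> / 4"
    by (auto simp: eventually_sequentially)
  have "norm ((\<Sum>\<^sub>\<infinity>x. \<bar>g x * r k x\<bar>) - 0) < \<epsilon>" if "k \<ge> N" for k
  proof -
    have "(\<Sum>\<^sub>\<infinity>x. \<bar>g x * r k x\<bar>) = (\<Sum>x\<in>F. \<bar>g x * r k x\<bar>) + (\<Sum>\<^sub>\<infinity>x\<in>-F. \<bar>g x * r k x\<bar>)"
      using summable_on_mult_squares[OF g r[of k]] by (intro split) simp
    moreover have "(\<Sum>\<^sub>\<infinity>x. \<bar>g x * r k x\<bar>) \<ge> 0" by (rule infsum_nonneg) simp
    ultimately show ?thesis using N[OF that] tail[of k] by simp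
  qed
  then show "\<exists>N. \<forall>k\<ge>N. norm ((\<Sum>\<^sub>\<infinity>x. \<bar>g x * r k x\<bar>) - 0) < \<epsilon>" by blast
qed

text \<open>Mean value theorem, the derivative being largest at \<open>y\<close>. The case
  \<open>x = 0\<close> is separate because the derivative rule for \<open>powr\<close> needs a
  positive base.\<close>

lemma powr_diff_le:
  fixes x y s :: real
  assumes "0 \<le> x" "x \<le> y" "1 \<le> s"
  shows "y powr s - x powr s \<le> s * y powr (s - 1) * (y - x)"
proof (cases "x = 0 \<or> x = y")
  case True
  then consider "x = y" | "x = 0" "y > 0" using assms by fastforce
  then show ?thesis
  proof cases
    case 2
    then have "s * y powr (s - 1) * (y - x) = s * y powr s"
      by (simp add: powr_diff)
    moreover have "y powr s \<le> s * y powr s"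
      using mult_right_mono[OF assms(3), of "y powr s"] by simp
    moreover have "x powr s = 0" using 2 by simp
    ultimately show ?thesis by linarith
  qed simp
next
  case False
  then have xy: "0 < x" "x < y" using assms by auto
  have "\<exists>z>x. z < y \<and> y powr s - x powr s = (y - x) * (s * z powr (s - 1))"
  proof (rule MVT2)
    fix z assume "x \<le> z" "z \<le> y"
    then show "((\<lambda>z. z powr s) has_real_derivative s * z powr (s - 1)) (at z)"
      using xy by (intro has_real_derivative_powr) auto
  qed (use xy in auto)
  then obtain z where z: "x < z" "z < y" "y powr s - x powr s = (y - x) * (s * z powr (s - 1))"
    by auto
  have "(y - x) * (s * z powr (s - 1)) \<le> (y - x) * (s * y powr (s - 1))"
    using z xy assms by (intro mult_left_mono powr_mono2) auto
  then show ?thesis using z by (simp add: mult_ac)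
qed

lemma abs_powr_diff_le:
  fixes x y s :: real
  assumes "0 \<le> x" "x \<le> Y" "0 \<le> y" "y \<le> Y" "1 \<le> s"
  shows "\<bar>y powr s - x powr s\<bar> \<le> s * Y powr (s - 1) * \<bar>y - x\<bar>"
proof -
  have *: "\<bar>b powr s - a powr s\<bar> \<le> s * Y powr (s - 1) * \<bar>b - a\<bar>"
    if "0 \<le> a" "a \<le> b" "b \<le> Y" for a b
  proof -
    have "b powr s - a powr s \<le> s * b powr (s - 1) * (b - a)"
      using powr_diff_le that assms by simp
    also have "\<dots> \<le> s * Y powr (s - 1) * (b - a)"
      using that assms by (intro mult_right_mono mult_left_mono powr_mono2) auto
    finally show ?thesis using that assms powr_mono2[of s a b] by simp
  qed
  show ?thesis using *[of x y] *[of y x] assms by (cases "x \<le> y") (auto simp: abs_minus_commute)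
qed

text \<open>Reduces the error of the power \<open>s\<close> to the product occurring in the
  quadratic case. For the smaller vector \<open>w\<close>, moving from \<open>z\<close> to
  \<open>z + w\<close> costs a multiple of \<open>norm z powr (s - 1) * norm w\<close>, and
  \<open>norm w powr s\<close> is smaller still; since \<open>2 \<le> s\<close>, the surplus power
  \<open>s - 2\<close> is absorbed by the bound \<open>M\<close>.\<close>

lemma norm_add_powr_split:
  fixes z w :: "'a::real_normed_vector"
  assumes "2 \<le> s" "norm z \<le> M" "norm w \<le> M"
  shows "\<bar>norm (z + w) powr s - norm z powr s - norm w powr s\<bar>
    \<le> (2 * s + 1) * (2 * M) powr (s - 2) * (norm z * norm w)"
proof -
  have *: "\<bar>norm (z + w) powr s - norm z powr s - norm w powr s\<bar>
      \<le> (2 * s + 1) * (2 * M) powr (s - 2) * (norm z * norm w)"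
    if le: "norm w \<le> norm z" and z: "norm z \<le> M" for z w :: 'a
  proof (cases "w = 0")
    case False
    define a b where "a = norm z" and "b = norm w"
    have ab: "0 < b" "b \<le> a" "a \<le> M" using False le z by (auto simp: a_def b_def)
    have sum_le: "norm (z + w) \<le> 2 * a"
      using norm_triangle_ineq[of z w] le by (simp add: a_def)
    have diff_le: "\<bar>norm (z + w) - a\<bar> \<le> b"
      using norm_triangle_ineq3[of "z + w" z] by (simp add: a_def b_def)
    have "\<bar>norm (z + w) powr s - a powr s\<bar> \<le> s * (2 * a) powr (s - 1) * \<bar>norm (z + w) - a\<bar>"
      using sum_le ab assms by (intro abs_powr_diff_le) auto
    also have "\<dots> \<le> s * (2 * a) powr (s - 1) * b"
      using diff_le assms by (intro mult_left_mono) auto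
    also have "(2 * a) powr (s - 1) = 2 * a * (2 * a) powr (s - 2)"
      using ab powr_add[of "2 * a" 1 "s - 2"] by simp
    also have "s * (2 * a * (2 * a) powr (s - 2)) * b = 2 * s * (2 * a) powr (s - 2) * (a * b)"
      by simp
    also have "\<dots> \<le> 2 * s * (2 * M) powr (s - 2) * (a * b)"
      using ab assms by (intro mult_right_mono mult_left_mono powr_mono2) auto
    finally have 1: "\<bar>norm (z + w) powr s - a powr s\<bar> \<le> 2 * s * (2 * M) powr (s - 2) * (a * b)" .
    have "b powr s = b powr (s - 2) * (b * b)"
      using ab powr_add[of b "s - 2" 2] by (simp add: power2_eq_square)
    also have "\<dots> \<le> (2 * M) powr (s - 2) * (a * b)"
      using ab assms by (intro mult_mono powr_mono2) auto
    finally have 2: "b powr s \<le> (2 * M) powr (s - 2) * (a * b)" .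
    have "b powr s \<ge> 0" by simp
    with 1 2 have "\<bar>norm (z + w) powr s - a powr s - b powr s\<bar>
        \<le> 2 * s * (2 * M) powr (s - 2) * (a * b) + (2 * M) powr (s - 2) * (a * b)"
      by linarith
    then show ?thesis by (simp add: a_def b_def algebra_simps)
  qed simp
  show ?thesis
  proof (cases "norm w \<le> norm z")
    case True
    then show ?thesis using * assms by blast
  next
    case False
    then show ?thesis using *[of z w] assms by (simp add: add.commute mult.commute diff_right_commute)
  qed
qed

subsection \<open>The quadratic form\<close>

text \<open>The double sum exhibits \<open>\<langle>Lu,u\<rangle>\<close> as a weighted \<open>l\<^sup>2\<close> norm over pairs of sites, so that it
  can be treated exactly like the mass.\<close>

definition energy :: "('a::ab_group_add \<Rightarrow> real) \<Rightarrow> ('a \<Rightarrow> complex) \<Rightarrow> real" where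
  "energy J u = (\<Sum>\<^sub>\<infinity>(n, m). J (n - m) * (norm (u n - u m))\<^sup>2) / 2"

definition square_summable :: "('a \<Rightarrow> complex) \<Rightarrow> bool" where
  "square_summable u \<longleftrightarrow> (\<lambda>n. (norm (u n))\<^sup>2) summable_on UNIV"

lemma norm_add_square_le:
  fixes x y :: "'a::real_normed_vector"
  shows "(norm (x + y))\<^sup>2 \<le> 2 * (norm x)\<^sup>2 + 2 * (norm y)\<^sup>2"
proof -
  have "(norm (x + y))\<^sup>2 \<le> (norm x + norm y)\<^sup>2"
    by (intro power_mono norm_triangle_ineq) auto
  also have "\<dots> \<le> 2 * (norm x)\<^sup>2 + 2 * (norm y)\<^sup>2"
    using zero_le_power2[of "norm x - norm y"] by (simp add: power2_sum power2_diff)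
  finally show ?thesis .
qed

lemma norm_diff_square_le:
  fixes x y :: "'a::real_normed_vector"
  shows "(norm (x - y))\<^sup>2 \<le> 2 * (norm x)\<^sup>2 + 2 * (norm y)\<^sup>2"
  using norm_add_square_le[of x "- y"] by simp

lemma square_summable_diff:
  assumes "square_summable u" "square_summable v"
  shows "square_summable (\<lambda>n. u n - v n)"
  unfolding square_summable_def
proof (rule summable_on_comparison_test)
  show "(\<lambda>n. 2 * (norm (u n))\<^sup>2 + 2 * (norm (v n))\<^sup>2) summable_on UNIV"
    using assms unfolding square_summable_def by (intro summable_on_add summable_on_cmult_right)
qed (use norm_diff_square_le in auto)

lemma square_summable_scale:
  assumes "square_summable u"
  shows "square_summable (\<lambda>n. complex_of_real c * u n)"
  using summable_on_cmult_right[OF assms[unfolded square_summable_def], of "c\<^sup>2"]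
  by (simp add: square_summable_def norm_mult power_mult_distrib)

lemma norm_square_le_infsum:
  assumes "square_summable u"
  shows "(norm (u n))\<^sup>2 \<le> (\<Sum>\<^sub>\<infinity>n. (norm (u n))\<^sup>2)"
  using finite_sum_le_infsum[OF assms[unfolded square_summable_def], of "{n}"] by simp

lemma energy_scale: "energy J (\<lambda>n. complex_of_real c * u n) = c\<^sup>2 * energy J u"
proof -
  have "(\<Sum>\<^sub>\<infinity>(n, m). J (n - m) * (norm (complex_of_real c * u n - complex_of_real c * u m))\<^sup>2)
    = (\<Sum>\<^sub>\<infinity>x. c\<^sup>2 * (case x of (n, m) \<Rightarrow> J (n - m) * (norm (u n - u m))\<^sup>2))"
    by (intro infsum_cong)
      (auto simp: norm_mult power_mult_distrib mult_ac simp flip: right_diff_distrib)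
  also have "\<dots> = c\<^sup>2 * (\<Sum>\<^sub>\<infinity>(n, m). J (n - m) * (norm (u n - u m))\<^sup>2)"
    by (rule infsum_cmult_right')
  finally show ?thesis by (simp add: energy_def)
qed

lemma energy_translate: "energy J (\<lambda>n. u (n + a)) = energy J u"
proof -
  have "bij_betw (\<lambda>(n, m). (n + a, m + a)) UNIV UNIV"
    by (rule bij_betwI[where g = "\<lambda>(n, m). (n - a, m - a)"]) auto
  from infsum_reindex_bij_betw[OF this, of "\<lambda>(n, m). J (n - m) * (norm (u n - u m))\<^sup>2"]
  show ?thesis by (simp add: energy_def case_prod_unfold)
qed

text \<open>The variational argument runs over an abelian group with these properties; the geometry
  of the lattice enters with the moments and the tents.\<close>

locale summable_kernel =
  fixes J :: "'a::ab_group_add \<Rightarrow> real"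
  assumes J_nonneg: "0 \<le> J n"
    and J_minus: "J (- n) = J n"
    and J_summable: "J summable_on UNIV"
begin

lemma energy_nonneg: "0 \<le> energy J u"
  unfolding energy_def using J_nonneg by (auto intro!: infsum_nonneg divide_nonneg_nonneg)

text \<open>The square of a difference is at most twice the sum of the squares, which leaves two
  convolution sums, each equal to the total kernel weight times the mass.\<close>

lemma
  assumes "square_summable u"
  shows energy_summable: "(\<lambda>(n, m). J (n - m) * (norm (u n - u m))\<^sup>2) summable_on UNIV"
    and energy_le: "energy J u \<le> 2 * infsum J UNIV * (\<Sum>\<^sub>\<infinity>n. (norm (u n))\<^sup>2)"
proof -
  define S where "S = infsum J UNIV * (\<Sum>\<^sub>\<infinity>n. (norm (u n))\<^sup>2)"
  define f where "f = (\<lambda>(n, m). 2 * (J (n - m) * (norm (u n))\<^sup>2) + 2 * (J (n - m) * (norm (u m))\<^sup>2))"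
  have hs: "((\<lambda>(n, m). J (n - m) * (norm (u n))\<^sup>2) has_sum S) UNIV"
    "((\<lambda>(n, m). J (n - m) * (norm (u m))\<^sup>2) has_sum S) UNIV"
    using has_sum_convolution[OF J_summable J_nonneg assms[unfolded square_summable_def]]
    by (simp_all add: S_def)
  have f: "(f has_sum (2 * S + 2 * S)) UNIV"
    using has_sum_add[OF has_sum_cmult_right[OF hs(1), of 2] has_sum_cmult_right[OF hs(2), of 2]]
    by (simp add: f_def case_prod_unfold)
  have le: "(\<lambda>(n, m). J (n - m) * (norm (u n - u m))\<^sup>2) x \<le> f x" for x
  proof -
    obtain n m where x: "x = (n, m)" by force
    have "J (n - m) * (norm (u n - u m))\<^sup>2 \<le> J (n - m) * (2 * (norm (u n))\<^sup>2 + 2 * (norm (u m))\<^sup>2)"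
      by (rule mult_left_mono[OF norm_diff_square_le J_nonneg])
    then show ?thesis unfolding x f_def by (simp add: algebra_simps)
  qed
  show *: "(\<lambda>(n, m). J (n - m) * (norm (u n - u m))\<^sup>2) summable_on UNIV"
    by (rule summable_on_comparison_test[OF has_sum_imp_summable[OF f]])
      (use le J_nonneg in auto)
  have "(\<Sum>\<^sub>\<infinity>(n, m). J (n - m) * (norm (u n - u m))\<^sup>2) \<le> infsum f UNIV"
    by (rule infsum_mono[OF * has_sum_imp_summable[OF f]]) (use le in auto)
  then show "energy J u \<le> 2 * infsum J UNIV * (\<Sum>\<^sub>\<infinity>n. (norm (u n))\<^sup>2)"
    using infsumI[OF f] by (simp add: energy_def S_def)
qed

text \<open>Symmetrization in the two sites. It is legitimate because the double sum converges
  absolutely, its terms being dominated by the energy density plus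
  \<open>J (n - m) * (norm (u n))\<^sup>2\<close>.\<close>

lemma infsum_form_eq_energy:
  assumes u: "square_summable u"
  shows "Re (\<Sum>\<^sub>\<infinity>n. (\<Sum>\<^sub>\<infinity>m\<in>UNIV - {n}. complex_of_real (J (n - m)) * (u n - u m)) * cnj (u n))
    = energy J u"
proof -
  define S where "S = infsum J UNIV * (\<Sum>\<^sub>\<infinity>n. (norm (u n))\<^sup>2)"
  have hs: "((\<lambda>(n, m). J (n - m) * (norm (u n))\<^sup>2) has_sum S) UNIV"
    using has_sum_convolution[OF J_summable J_nonneg u[unfolded square_summable_def]]
    by (simp_all add: S_def)
  define f where "f = (\<lambda>(n, m). complex_of_real (J (n - m)) * (u n - u m) * cnj (u n))"
  define e where "e = (\<lambda>(n, m). J (n - m) * (norm (u n - u m))\<^sup>2)"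
  have "(\<lambda>x. norm (f x)) summable_on UNIV"
  proof (rule summable_on_comparison_test)
    show "(\<lambda>x. e x + (case x of (n, m) \<Rightarrow> J (n - m) * (norm (u n))\<^sup>2)) summable_on UNIV"
      using energy_summable[OF u] has_sum_imp_summable[OF hs]
      unfolding e_def by (rule summable_on_add)
    fix x :: "'a \<times> 'a"
    obtain n m where x: "x = (n, m)" by force
    have "a * b \<le> a\<^sup>2 + b\<^sup>2" if "0 \<le> a" "0 \<le> b" for a b :: real
      using zero_le_power2[of "a - b"] mult_nonneg_nonneg[OF that]
      unfolding power2_diff by linarith
    from mult_left_mono[OF this[OF norm_ge_zero norm_ge_zero] J_nonneg[of "n - m"]]
    have "J (n - m) * (norm (u n - u m) * norm (u n))
        \<le> J (n - m) * (norm (u n - u m))\<^sup>2 + J (n - m) * (norm (u n))\<^sup>2"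
      unfolding distrib_left .
    then show "norm (f x) \<le> e x + (case x of (n, m) \<Rightarrow> J (n - m) * (norm (u n))\<^sup>2)"
      unfolding x f_def e_def by (simp add: norm_mult J_nonneg mult_ac)
  qed auto
  then have f: "f summable_on UNIV" by (rule abs_summable_summable)
  have inner: "(\<Sum>\<^sub>\<infinity>m. f (n, m))
      = (\<Sum>\<^sub>\<infinity>m\<in>UNIV - {n}. complex_of_real (J (n - m)) * (u n - u m)) * cnj (u n)" for n
  proof -
    have "(\<Sum>\<^sub>\<infinity>m. f (n, m))
        = (\<Sum>\<^sub>\<infinity>m\<in>UNIV - {n}. complex_of_real (J (n - m)) * (u n - u m) * cnj (u n))"
      \<comment> \<open>The diagonal term can be restored since
        \<open>u n - u n = 0\<close>.\<close>
      by (rule infsum_cong_neutral) (auto simp: f_def)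
    then show ?thesis by (simp add: infsum_cmult_left')
  qed
  have bij: "bij_betw prod.swap UNIV (UNIV :: ('a \<times> 'a) set)"
    by (simp add: bij_betw_def)
  have swap: "infsum (f \<circ> prod.swap) UNIV = infsum f UNIV" "(f \<circ> prod.swap) summable_on UNIV"
    using infsum_reindex_bij_betw[OF bij, of f] summable_on_reindex_bij_betw[OF bij, of f] f
    by (simp_all add: o_def)
  \<comment> \<open>Swapping the sites changes the sign of \<open>u n - u m\<close> and keeps the
    even kernel, so the two conjugate factors combine to \<open>cnj (u n - u m)\<close>.\<close>
  have e: "complex_of_real (e x) = f x + (f \<circ> prod.swap) x" for x
  proof -
    obtain n m where x: "x = (n, m)" by force
    have "complex_of_real (e x) = complex_of_real (J (n - m)) * ((u n - u m) * cnj (u n - u m))"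
      by (simp only: x e_def case_prod_conv of_real_mult complex_norm_square)
    moreover have "J (m - n) = J (n - m)" using J_minus[of "n - m"] by simp
    ultimately show ?thesis by (simp add: x f_def algebra_simps)
  qed
  have "2 * energy J u = infsum e UNIV" by (simp add: energy_def e_def)
  also have "complex_of_real \<dots> = infsum (\<lambda>x. complex_of_real (e x)) UNIV"
    using energy_summable[OF u] unfolding e_def[symmetric]
    by (intro infsumI[symmetric] has_sum_of_real) simp
  also have "\<dots> = 2 * infsum f UNIV"
    unfolding e infsum_add[OF f swap(2)] swap(1) by simp
  finally have "infsum f UNIV = complex_of_real (energy J u)" by simp
  moreover have "infsum f UNIV = (\<Sum>\<^sub>\<infinity>n. \<Sum>\<^sub>\<infinity>m. f (n, m))"
    using infsum_Sigma_banach[of f UNIV "\<lambda>_. UNIV"] f by simp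
  ultimately show ?thesis by (simp add: inner)
qed

end

lemma norm_square_split: "(norm z)\<^sup>2 = (norm w)\<^sup>2 + (norm (z - w))\<^sup>2 + 2 * (w \<bullet> (z - w))"
  for z w :: "'a::real_inner"
  using dot_norm[of w "z - w"] by (simp add: field_simps)

text \<open>The cross terms of the splitting \<open>q\<^sub>k = v + (q\<^sub>k - v)\<close> vanish along a bounded pointwise
  convergent sequence; the lemma is applied to sites and to pairs of sites alike.\<close>

lemma square_sum_split:
  fixes q :: "nat \<Rightarrow> 'a \<Rightarrow> 'b::real_inner" and v :: "'a \<Rightarrow> 'b"
  assumes q: "\<And>k. (\<lambda>x. (norm (q k x))\<^sup>2) summable_on UNIV"
    and v: "(\<lambda>x. (norm (v x))\<^sup>2) summable_on UNIV"
    and C: "\<And>k. (\<Sum>\<^sub>\<infinity>x. (norm (q k x))\<^sup>2) \<le> C"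
    and lim: "\<And>x. (\<lambda>k. q k x) \<longlonglongrightarrow> v x"
  shows "(\<lambda>k. (\<Sum>\<^sub>\<infinity>x. (norm (q k x))\<^sup>2) - (\<Sum>\<^sub>\<infinity>x. (norm (q k x - v x))\<^sup>2))
      \<longlonglongrightarrow> (\<Sum>\<^sub>\<infinity>x. (norm (v x))\<^sup>2)"
    and "(\<lambda>k. \<Sum>\<^sub>\<infinity>x. \<bar>norm (v x) * norm (q k x - v x)\<bar>) \<longlonglongrightarrow> 0"
proof -
  define V where "V = (\<Sum>\<^sub>\<infinity>x. (norm (v x))\<^sup>2)"
  have dom: "(\<lambda>x. 2 * (norm (q k x))\<^sup>2 + 2 * (norm (v x))\<^sup>2) summable_on UNIV" for k
    by (intro summable_on_add summable_on_cmult_right q v)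
  have r: "(\<lambda>x. (norm (q k x - v x))\<^sup>2) summable_on UNIV" for k
    by (rule summable_on_comparison_test[OF dom[of k]]) (use norm_diff_square_le in auto)
  have "(\<Sum>\<^sub>\<infinity>x. (norm (q k x - v x))\<^sup>2) \<le> 2 * C + 2 * V" for k
  proof -
    have "(\<Sum>\<^sub>\<infinity>x. (norm (q k x - v x))\<^sup>2) \<le> (\<Sum>\<^sub>\<infinity>x. 2 * (norm (q k x))\<^sup>2 + 2 * (norm (v x))\<^sup>2)"
      by (rule infsum_mono[OF r dom]) (use norm_diff_square_le in auto)
    also have "\<dots> = 2 * (\<Sum>\<^sub>\<infinity>x. (norm (q k x))\<^sup>2) + 2 * V"
      unfolding V_def
      by (simp only: infsum_add[OF summable_on_cmult_right[OF q] summable_on_cmult_right[OF v]]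
          infsum_cmult_right')
    finally show ?thesis using C[of k] by simp
  qed
  then show cross: "(\<lambda>k. \<Sum>\<^sub>\<infinity>x. \<bar>norm (v x) * norm (q k x - v x)\<bar>) \<longlonglongrightarrow> 0"
    using v r by (intro cross_sum_tendsto_0 tendsto_norm_zero LIM_zero lim)
  define c where "c = (\<lambda>k. \<Sum>\<^sub>\<infinity>x. v x \<bullet> (q k x - v x))"
  have abs: "(\<lambda>x. \<bar>norm (v x) * norm (q k x - v x)\<bar>) summable_on UNIV" for k
    using v r by (rule summable_on_mult_squares)
  have cs: "(\<lambda>x. norm (v x \<bullet> (q k x - v x))) summable_on UNIV" for k
    by (rule summable_on_comparison_test[OF abs[of k]])
      (use Cauchy_Schwarz_ineq2 in \<open>auto simp: abs_mult\<close>)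
  have cs': "(\<lambda>x. v x \<bullet> (q k x - v x)) summable_on UNIV" for k
    using cs by (rule abs_summable_summable)
  have "norm (c k) \<le> (\<Sum>\<^sub>\<infinity>x. \<bar>norm (v x) * norm (q k x - v x)\<bar>)" for k
  proof -
    have "norm (c k) \<le> (\<Sum>\<^sub>\<infinity>x. norm (v x \<bullet> (q k x - v x)))"
      unfolding c_def by (rule norm_infsum_bound) (rule cs)
    also have "\<dots> \<le> (\<Sum>\<^sub>\<infinity>x. \<bar>norm (v x) * norm (q k x - v x)\<bar>)"
      by (rule infsum_mono[OF cs abs]) (use Cauchy_Schwarz_ineq2 in \<open>auto simp: abs_mult\<close>)
    finally show ?thesis .
  qed
  then have "c \<longlonglongrightarrow> 0"
    by (intro Lim_null_comparison[OF _ cross]) auto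
  have "(\<Sum>\<^sub>\<infinity>x. (norm (q k x))\<^sup>2) - (\<Sum>\<^sub>\<infinity>x. (norm (q k x - v x))\<^sup>2) = V + 2 * c k" for k
  proof -
    have "(\<Sum>\<^sub>\<infinity>x. (norm (q k x))\<^sup>2)
        = (\<Sum>\<^sub>\<infinity>x. (norm (v x))\<^sup>2 + (norm (q k x - v x))\<^sup>2 + 2 * (v x \<bullet> (q k x - v x)))"
      by (intro infsum_cong norm_square_split)
    also have "\<dots> = V + (\<Sum>\<^sub>\<infinity>x. (norm (q k x - v x))\<^sup>2) + 2 * c k"
      unfolding V_def c_def
      by (simp only: infsum_add[OF summable_on_add[OF v r] summable_on_cmult_right[OF cs']]
          infsum_add[OF v r] infsum_cmult_right')
    finally show ?thesis by simp
  qed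
  then show "(\<lambda>k. (\<Sum>\<^sub>\<infinity>x. (norm (q k x))\<^sup>2) - (\<Sum>\<^sub>\<infinity>x. (norm (q k x - v x))\<^sup>2)) \<longlonglongrightarrow> V"
    using tendsto_add[OF tendsto_const tendsto_mult_right_zero[OF \<open>c \<longlonglongrightarrow> 0\<close>], of V 2] by simp
qed

subsection \<open>Scaling and splitting of the energy functional\<close>

definition power_sum :: "real \<Rightarrow> ('a \<Rightarrow> complex) \<Rightarrow> real" where
  "power_sum s u = (\<Sum>\<^sub>\<infinity>n. norm (u n) powr s)"

abbreviation square_sum :: "('a \<Rightarrow> complex) \<Rightarrow> real" where
  "square_sum u \<equiv> (\<Sum>\<^sub>\<infinity>n. (norm (u n))\<^sup>2)"

definition energy_functional :: "real \<Rightarrow> ('a::ab_group_add \<Rightarrow> real) \<Rightarrow> ('a \<Rightarrow> complex) \<Rightarrow> real" where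
  "energy_functional p J u = energy J u / 2 - power_sum (p + 1) u / (p + 1)"

lemma norm_le_sqrt_square_sum:
  assumes "square_summable u"
  shows "norm (u n) \<le> sqrt (square_sum u)"
  using norm_square_le_infsum[OF assms] by (rule real_le_rsqrt)

lemma norm_powr_le:
  assumes "2 \<le> s" "norm z \<le> c"
  shows "norm z powr s \<le> c powr (s - 2) * (norm z)\<^sup>2"
proof (cases "z = 0")
  case False
  then have "norm z powr s = norm z powr (s - 2) * (norm z)\<^sup>2"
    using powr_add[of "norm z" "s - 2" 2] by simp
  also have "\<dots> \<le> c powr (s - 2) * (norm z)\<^sup>2"
    using assms by (intro mult_right_mono powr_mono2) auto
  finally show ?thesis .
qed simp

text \<open>Embedding of l^2 into l^s by way of the sup norm. The version with a free bound
  \<open>c\<close> is what later excludes vanishing: small amplitudes force a small power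
  sum.\<close>

lemma
  assumes u: "square_summable u" and s: "2 \<le> s"
  shows power_summable: "(\<lambda>n. norm (u n) powr s) summable_on UNIV"
    and power_sum_le: "(\<And>n. norm (u n) \<le> c) \<Longrightarrow> power_sum s u \<le> c powr (s - 2) * square_sum u"
proof -
  have dom: "(\<lambda>n. c powr (s - 2) * (norm (u n))\<^sup>2) summable_on UNIV" for c
    using u unfolding square_summable_def by (rule summable_on_cmult_right)
  show *: "(\<lambda>n. norm (u n) powr s) summable_on UNIV"
    by (rule summable_on_comparison_test[OF dom])
      (use norm_powr_le[OF s norm_le_sqrt_square_sum[OF u]] in auto)
  show "power_sum s u \<le> c powr (s - 2) * square_sum u" if "\<And>n. norm (u n) \<le> c"
    unfolding power_sum_def infsum_cmult_right'[symmetric]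
    by (rule infsum_mono[OF * dom]) (use norm_powr_le[OF s that] in auto)
qed

lemma power_sum_nonneg: "0 \<le> power_sum s u"
  unfolding power_sum_def by (rule infsum_nonneg) simp

lemma power_sum_pos:
  assumes "square_summable u" "2 \<le> s" "u n \<noteq> 0"
  shows "0 < power_sum s u"
proof -
  have "0 < norm (u n) powr s" using assms by simp
  also have "\<dots> \<le> power_sum s u"
    using finite_sum_le_infsum[OF power_summable[OF assms(1,2)], of "{n}"]
    by (simp add: power_sum_def)
  finally show ?thesis .
qed

lemma power_sum_scale:
  assumes "0 \<le> c"
  shows "power_sum s (\<lambda>n. complex_of_real c * u n) = c powr s * power_sum s u"
  unfolding power_sum_def using assms
  by (simp add: norm_mult powr_mult infsum_cmult_right')

lemma square_sum_scale:
  "square_sum (\<lambda>n. complex_of_real c * u n) = c\<^sup>2 * square_sum u"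
  by (simp add: norm_mult power_mult_distrib infsum_cmult_right')

text \<open>A Brezis-Lieb splitting. The pointwise error is bounded by
  \<open>norm_add_powr_split\<close>, applied to \<open>v x\<close> and \<open>q k x - v x\<close>,
  hence by the cross sum that \<open>square_sum_split\<close> sends to 0.\<close>

lemma power_sum_split:
  fixes q :: "nat \<Rightarrow> 'a \<Rightarrow> complex"
  assumes q: "\<And>k. square_summable (q k)" and v: "square_summable v"
    and C: "\<And>k. square_sum (q k) \<le> C"
    and lim: "\<And>x. (\<lambda>k. q k x) \<longlonglongrightarrow> v x" and s: "2 \<le> s"
  shows "(\<lambda>k. power_sum s (q k) - power_sum s (\<lambda>x. q k x - v x)) \<longlonglongrightarrow> power_sum s v"
proof -
  define B where "B = (\<lambda>k. \<Sum>\<^sub>\<infinity>x. \<bar>norm (v x) * norm (q k x - v x)\<bar>)"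
  have B: "B \<longlonglongrightarrow> 0"
    unfolding B_def using q v unfolding square_summable_def
    by (intro square_sum_split(2)[OF _ _ C lim])
  \<comment> \<open>A common sup bound for \<open>v\<close> and for all remainders
    \<open>q k - v\<close>.\<close>
  define M where "M = sqrt C + sqrt (square_sum v)"
  define A where "A = (2 * s + 1) * (2 * M) powr (s - 2)"
  have qM: "norm (q k x) \<le> sqrt C" for k x
    using norm_le_sqrt_square_sum[OF q, of k x] C[of k] by (meson order_trans real_sqrt_le_mono)
  have vM: "norm (v x) \<le> sqrt (square_sum v)" for x
    by (rule norm_le_sqrt_square_sum[OF v])
  have r: "square_summable (\<lambda>x. q k x - v x)" for k
    by (rule square_summable_diff[OF q v])
  define e where "e = (\<lambda>k x. norm (q k x) powr s - norm (q k x - v x) powr s - norm (v x) powr s)"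
  have e_le: "norm (e k x) \<le> A * \<bar>norm (v x) * norm (q k x - v x)\<bar>" for k x
  proof -
    have "0 \<le> C" using C[of 0] infsum_nonneg[of UNIV "\<lambda>x. (norm (q 0 x))\<^sup>2"] by simp
    then have "norm (v x) \<le> M" "norm (q k x - v x) \<le> M"
      using qM[of k x] vM[of x] norm_triangle_ineq4[of "q k x" "v x"] by (auto simp: M_def add_increasing)
    from norm_add_powr_split[OF s this(2,1)] show ?thesis
      by (simp add: A_def e_def abs_mult mult_ac)
  qed
  have abs: "(\<lambda>x. \<bar>norm (v x) * norm (q k x - v x)\<bar>) summable_on UNIV" for k
    using v r unfolding square_summable_def by (rule summable_on_mult_squares)
  have dom: "(\<lambda>x. A * \<bar>norm (v x) * norm (q k x - v x)\<bar>) summable_on UNIV" for k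
    by (rule summable_on_cmult_right[OF abs])
  have es: "(\<lambda>x. norm (e k x)) summable_on UNIV" for k
    by (rule summable_on_comparison_test[OF dom]) (use e_le in auto)
  note ps = power_summable[OF _ s]
  have eq: "infsum (e k) UNIV = power_sum s (q k) - power_sum s (\<lambda>x. q k x - v x) - power_sum s v" for k
  proof -
    have "power_sum s (q k) = (\<Sum>\<^sub>\<infinity>x. e k x + (norm (q k x - v x) powr s + norm (v x) powr s))"
      unfolding power_sum_def by (intro infsum_cong) (simp add: e_def)
    also have "\<dots> = infsum (e k) UNIV + (power_sum s (\<lambda>x. q k x - v x) + power_sum s v)"
      unfolding power_sum_def
      by (simp only: infsum_add[OF abs_summable_summable[OF es] summable_on_add[OF ps[OF r] ps[OF v]]]
          infsum_add[OF ps[OF r] ps[OF v]])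
    finally show ?thesis by simp
  qed
  have "norm (infsum (e k) UNIV) \<le> A * B k" for k
  proof -
    have "norm (infsum (e k) UNIV) \<le> (\<Sum>\<^sub>\<infinity>x. norm (e k x))"
      by (rule norm_infsum_bound[OF es])
    also have "\<dots> \<le> (\<Sum>\<^sub>\<infinity>x. A * \<bar>norm (v x) * norm (q k x - v x)\<bar>)"
      by (rule infsum_mono[OF es dom]) (use e_le in auto)
    finally show ?thesis by (simp only: infsum_cmult_right' B_def)
  qed
  then have "(\<lambda>k. infsum (e k) UNIV) \<longlonglongrightarrow> 0"
    by (intro Lim_null_comparison[OF _ tendsto_mult_right_zero[OF B, of A]]) auto
  from tendsto_add[OF this tendsto_const[of "power_sum s v"]] show ?thesis
    by (simp add: eq)
qed

context summable_kernel
begin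

lemma energy_split:
  fixes q :: "nat \<Rightarrow> 'a \<Rightarrow> complex"
  assumes q: "\<And>k. square_summable (q k)" and v: "square_summable v"
    and C: "\<And>k. square_sum (q k) \<le> C"
    and lim: "\<And>x. (\<lambda>k. q k x) \<longlonglongrightarrow> v x"
  shows "(\<lambda>k. energy J (q k) - energy J (\<lambda>x. q k x - v x)) \<longlonglongrightarrow> energy J v"
proof -
  \<comment> \<open>\<open>T\<close> is linear, continuous for pointwise convergence, and its square
    sum over pairs is twice the energy, so the splitting of square sums applies to
    \<open>T (q k)\<close>.\<close>
  define T where "T = (\<lambda>(u :: 'a \<Rightarrow> complex) (n, m). sqrt (J (n - m)) *\<^sub>R (u n - u m))"
  have T: "(\<lambda>x. (norm (T u x))\<^sup>2) = (\<lambda>(n, m). J (n - m) * (norm (u n - u m))\<^sup>2)" for u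
    by (auto simp: T_def power_mult_distrib J_nonneg)
  have T_diff: "T u x - T w x = T (\<lambda>x. u x - w x) x" for u w x
    by (cases x) (simp add: T_def flip: scaleR_diff_right)
  have E: "energy J u = (\<Sum>\<^sub>\<infinity>x. (norm (T u x))\<^sup>2) / 2" for u
    by (simp add: energy_def T)
  have "(\<lambda>k. (\<Sum>\<^sub>\<infinity>x. (norm (T (q k) x))\<^sup>2) - (\<Sum>\<^sub>\<infinity>x. (norm (T (q k) x - T v x))\<^sup>2))
      \<longlonglongrightarrow> (\<Sum>\<^sub>\<infinity>x. (norm (T v x))\<^sup>2)"
  proof (rule square_sum_split(1)[where C = "2 * (2 * infsum J UNIV * C)"])
    show "(\<lambda>x. (norm (T (q k) x))\<^sup>2) summable_on UNIV" for k
      unfolding T by (rule energy_summable[OF q])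
    show "(\<lambda>x. (norm (T v x))\<^sup>2) summable_on UNIV"
      unfolding T by (rule energy_summable[OF v])
    fix k
    have "energy J (q k) \<le> 2 * infsum J UNIV * C"
      using energy_le[OF q, of k] mult_left_mono[OF C[of k], of "2 * infsum J UNIV"]
        infsum_nonneg[of UNIV J] J_nonneg by simp
    then show "(\<Sum>\<^sub>\<infinity>x. (norm (T (q k) x))\<^sup>2) \<le> 2 * (2 * infsum J UNIV * C)"
      by (simp add: E)
  next
    fix x :: "'a \<times> 'a"
    obtain n m where "x = (n, m)" by force
    then show "(\<lambda>k. T (q k) x) \<longlonglongrightarrow> T v x"
      by (auto simp: T_def intro!: tendsto_intros lim)
  qed
  from tendsto_divide[OF this tendsto_const[of 2]] show ?thesis
    by (simp add: E T_diff diff_divide_distrib)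
qed

lemma energy_functional_split:
  fixes q :: "nat \<Rightarrow> 'a \<Rightarrow> complex"
  assumes q: "\<And>k. square_summable (q k)" and v: "square_summable v"
    and C: "\<And>k. square_sum (q k) \<le> C"
    and lim: "\<And>x. (\<lambda>k. q k x) \<longlonglongrightarrow> v x" and p: "p > 1"
  shows "(\<lambda>k. energy_functional p J (q k) - energy_functional p J (\<lambda>x. q k x - v x))
    \<longlonglongrightarrow> energy_functional p J v"
proof -
  have "(\<lambda>k. (energy J (q k) - energy J (\<lambda>x. q k x - v x)) / 2
      - (power_sum (p + 1) (q k) - power_sum (p + 1) (\<lambda>x. q k x - v x)) / (p + 1))
    \<longlonglongrightarrow> energy_functional p J v"
    unfolding energy_functional_def using p
    by (intro tendsto_intros energy_split[OF q v C lim] power_sum_split[OF q v C lim]) auto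
  then show ?thesis
    by (simp add: energy_functional_def diff_divide_distrib algebra_simps)
qed

text \<open>Scaling \<open>u\<close> up to mass \<open>\<nu>\<close> multiplies the quadratic part by \<open>\<theta> = \<nu> / square_sum u\<close> and the
  focusing part by the larger factor \<open>\<theta>\<^bsup>(p+1)/2\<^esup>\<close>.\<close>

lemma energy_functional_ge:
  assumes u: "square_summable u" and p: "p > 1" and \<nu>: "\<nu> > 0" "square_sum u \<le> \<nu>"
    and I: "\<And>w. square_summable w \<Longrightarrow> square_sum w = \<nu> \<Longrightarrow> I \<le> energy_functional p J w"
  shows "square_sum u / \<nu> * I \<le> energy_functional p J u" (is ?weak)
    and "0 < square_sum u \<Longrightarrow> square_sum u < \<nu> \<Longrightarrow> square_sum u / \<nu> * I < energy_functional p J u"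
proof -
  define m where "m = square_sum u"
  have m_nonneg: "0 \<le> m" unfolding m_def by (rule infsum_nonneg) simp
  \<comment> \<open>The gain from rescaling is kept as an explicit term: nonnegative for the weak
    inequality, positive for the strict one.\<close>
  have scaled: "m / \<nu> * I + ((\<nu> / m) powr ((p - 1) / 2) - 1) * power_sum (p + 1) u / (p + 1)
      \<le> energy_functional p J u" if m: "0 < m"
  proof -
    define \<theta> where "\<theta> = \<nu> / m"
    define P where "P = power_sum (p + 1) u / (p + 1)"
    have \<theta>: "\<theta> > 0" using m \<nu> by (simp add: \<theta>_def)
    let ?w = "\<lambda>n. complex_of_real (sqrt \<theta>) * u n"
    have "square_sum ?w = \<nu>"
      using \<theta> m by (simp only: square_sum_scale) (simp add: \<theta>_def flip: m_def)
    then have "I \<le> energy_functional p J ?w"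
      by (intro I square_summable_scale[OF u])
    also have "sqrt \<theta> powr (p + 1) = \<theta> powr ((p + 1) / 2)"
      using \<theta> by (simp add: powr_half_sqrt[symmetric] powr_powr)
    then have "energy_functional p J ?w = \<theta> * (energy J u / 2) - \<theta> powr ((p + 1) / 2) * P"
      using \<theta> by (simp add: energy_functional_def energy_scale power_sum_scale P_def)
    also have "\<theta> powr ((p + 1) / 2) = \<theta> * \<theta> powr ((p - 1) / 2)"
      using \<theta> powr_add[of \<theta> 1 "(p - 1) / 2"] by (simp add: add_divide_distrib diff_divide_distrib add.commute)
    also have "\<theta> * (energy J u / 2) - \<theta> * \<theta> powr ((p - 1) / 2) * P
        = \<theta> * (energy_functional p J u - (\<theta> powr ((p - 1) / 2) - 1) * P)"
      by (simp add: energy_functional_def P_def algebra_simps)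
    finally have "I / \<theta> \<le> energy_functional p J u - (\<theta> powr ((p - 1) / 2) - 1) * P"
      using \<theta> by (simp add: field_simps)
    then show ?thesis by (simp add: \<theta>_def P_def le_diff_eq mult.commute)
  qed
  show ?weak
  proof (cases "m = 0")
    case True
    have "u n = 0" for n
      using norm_square_le_infsum[OF u, of n] True by (simp add: m_def)
    then show ?thesis using True by (simp add: energy_functional_def power_sum_def energy_def case_prod_unfold)
  next
    case False
    then have "0 < m" using m_nonneg by simp
    moreover have "1 \<le> (\<nu> / m) powr ((p - 1) / 2)"
      using \<open>0 < m\<close> \<nu> p by (intro ge_one_powr_ge_zero) (auto simp flip: m_def)
    then have "0 \<le> ((\<nu> / m) powr ((p - 1) / 2) - 1) * power_sum (p + 1) u / (p + 1)"
      using power_sum_nonneg[of "p + 1" u] p by simp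
    ultimately show ?thesis using scaled by (simp flip: m_def)
  qed
  show "square_sum u / \<nu> * I < energy_functional p J u" if "0 < square_sum u" "square_sum u < \<nu>"
  proof -
    have m: "0 < m" "m < \<nu>" using that by (simp_all add: m_def)
    have "\<exists>n. u n \<noteq> 0"
    proof (rule ccontr)
      assume "\<not> (\<exists>n. u n \<noteq> 0)"
      then have "m = 0" by (simp add: m_def)
      then show False using m by simp
    qed
    then have "0 < power_sum (p + 1) u" using power_sum_pos[OF u, of "p + 1"] p by auto
    moreover have "1 < (\<nu> / m) powr ((p - 1) / 2)"
      using m p by (intro gr_one_powr) auto
    ultimately have "0 < ((\<nu> / m) powr ((p - 1) / 2) - 1) * power_sum (p + 1) u / (p + 1)"
      using p by simp
    then show ?thesis using scaled m by (simp flip: m_def)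
  qed
qed

end

subsection \<open>Existence of minimizers\<close>

lemma square_sum_translate: "square_sum (\<lambda>n. u (n + a)) = square_sum u"
  for u :: "'a::ab_group_add \<Rightarrow> complex"
  by (rule infsum_reindex_bij_betw[of "\<lambda>n. n + a" UNIV UNIV "\<lambda>n. (norm (u n))\<^sup>2"])
    (rule bij_betwI[where g = "\<lambda>n. n - a"], auto)

lemma power_sum_translate: "power_sum s (\<lambda>n. u (n + a)) = power_sum s u"
  for u :: "'a::ab_group_add \<Rightarrow> complex"
  unfolding power_sum_def
  by (rule infsum_reindex_bij_betw[of "\<lambda>n. n + a" UNIV UNIV "\<lambda>n. norm (u n) powr s"])
    (rule bij_betwI[where g = "\<lambda>n. n - a"], auto)

lemma square_summable_translate:
  "square_summable (\<lambda>n. u (n + a)) \<longleftrightarrow> square_summable u"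
  for u :: "'a::ab_group_add \<Rightarrow> complex"
  unfolding square_summable_def
  by (rule summable_on_reindex_bij_betw[of "\<lambda>n. n + a" UNIV UNIV "\<lambda>n. (norm (u n))\<^sup>2"])
    (rule bij_betwI[where g = "\<lambda>n. n - a"], auto)

text \<open>Fatou's lemma for sums: the bound passes to the limit on each finite set of
  sites.\<close>

lemma square_summable_limit:
  assumes q: "\<And>k. square_summable (q k)" and C: "\<And>k. square_sum (q k) \<le> C"
    and lim: "\<And>x. (\<lambda>k. q k x) \<longlonglongrightarrow> v x"
  shows "square_summable v" and "square_sum v \<le> C"
proof -
  have le: "(\<Sum>x\<in>F. (norm (v x))\<^sup>2) \<le> C" if "finite F" for F
  proof (rule LIMSEQ_le_const2)
    show "(\<lambda>k. \<Sum>x\<in>F. (norm (q k x))\<^sup>2) \<longlonglongrightarrow> (\<Sum>x\<in>F. (norm (v x))\<^sup>2)"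
      by (intro tendsto_intros lim)
    have "(\<Sum>x\<in>F. (norm (q k x))\<^sup>2) \<le> C" for k
      using finite_sum_le_infsum[OF q[unfolded square_summable_def], of F k] that C[of k] by force
    then show "\<exists>N. \<forall>k\<ge>N. (\<Sum>x\<in>F. (norm (q k x))\<^sup>2) \<le> C" by blast
  qed
  then show *: "square_summable v"
    unfolding square_summable_def
    by (intro nonneg_bdd_above_summable_on bdd_aboveI2[where M = C]) auto
  show "square_sum v \<le> C"
    using * le unfolding square_summable_def by (intro infsum_le_finite_sums) auto
qed

text \<open>A minimizing sequence with negative energy cannot vanish in the supremum norm, so after
  translation it has a nonzero pointwise limit \<open>v\<close>. Splitting off \<open>v\<close> and using the scaling
  inequality for the remainder gives \<open>H v \<le> (square_sum v / \<nu>) I\<close>, while strictness of that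
  inequality forbids \<open>square_sum v < \<nu>\<close>. No strict subadditivity in the mass is needed.\<close>

theorem energy_functional_has_minimizer:
  fixes J :: "'a::{countable,ab_group_add} \<Rightarrow> real"
  assumes J: "summable_kernel J" and p: "p > 1" and \<nu>: "\<nu> > 0"
    and w: "square_summable w" "square_sum w = \<nu>" "energy_functional p J w < 0"
  obtains v where "square_summable v" "square_sum v = \<nu>"
    "\<And>u. square_summable u \<Longrightarrow> square_sum u = \<nu> \<Longrightarrow> energy_functional p J v \<le> energy_functional p J u"
proof -
  interpret summable_kernel J by (rule J)
  define H where "H = energy_functional p J"
  define A where "A = {u :: 'a \<Rightarrow> complex. square_summable u \<and> square_sum u = \<nu>}"
  define I where "I = (INF u\<in>A. H u)"
  have H_ge: "- (power_sum (p + 1) u / (p + 1)) \<le> H u" for u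
    using energy_nonneg by (simp add: H_def energy_functional_def)
  have bdd: "bdd_below (H ` A)"
  proof (rule bdd_belowI2)
    fix u assume u: "u \<in> A"
    then have "power_sum (p + 1) u \<le> sqrt \<nu> powr (p + 1 - 2) * \<nu>"
      using power_sum_le[of u "p + 1" "sqrt \<nu>"] norm_le_sqrt_square_sum[of u] p
      by (auto simp: A_def)
    then have "power_sum (p + 1) u / (p + 1) \<le> sqrt \<nu> powr (p + 1 - 2) * \<nu> / (p + 1)"
      using p by (intro divide_right_mono) auto
    then show "- (sqrt \<nu> powr (p + 1 - 2) * \<nu> / (p + 1)) \<le> H u"
      using H_ge[of u] by linarith
  qed
  have I_le: "I \<le> H u" if "square_summable u" "square_sum u = \<nu>" for u
    unfolding I_def using that by (intro cINF_lower[OF bdd]) (auto simp: A_def)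
  have "w \<in> A" using w by (simp add: A_def)
  have I_neg: "I < 0" using I_le[OF w(1,2)] w(3) by (simp add: H_def)

  \<comment> \<open>The slack tends to 0 and never exceeds \<open>- I / 2\<close>, so every member
    of the sequence has energy below \<open>I / 2\<close>, uniformly in \<open>k\<close>.\<close>
  have "\<exists>u. u \<in> A \<and> H u < I + (- I / 2) / real (Suc k)" for k
  proof -
    have "I < I + (- I / 2) / real (Suc k)" using I_neg by (simp add: divide_neg_pos)
    then show ?thesis
      using cINF_less_iff[OF _ bdd, of "I + (- I / 2) / real (Suc k)"] \<open>w \<in> A\<close>
      unfolding I_def[symmetric] by blast
  qed
  then obtain q0 where q0: "\<And>k. q0 k \<in> A" "\<And>k. H (q0 k) < I + (- I / 2) / real (Suc k)"
    by metis
  \<comment> \<open>A power sum of at most \<open>\<delta>\<close> would give energy at least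
    \<open>I / 2\<close>. The amplitude \<open>c\<close> solves
    \<open>c powr (p - 1) * \<nu> = \<delta>\<close>, so each \<open>q0 k\<close> must exceed
    \<open>c\<close> somewhere.\<close>
  define \<delta> where "\<delta> = (p + 1) * (- I / 2)"
  define c where "c = (\<delta> / \<nu>) powr (1 / (p - 1))"
  have \<delta>: "\<delta> > 0" using I_neg p by (simp add: \<delta>_def mult_pos_neg)
  have c: "c > 0" "c powr (p - 1) * \<nu> = \<delta>"
    using \<delta> \<nu> p by (simp_all add: c_def powr_powr)
  have "\<exists>a. c < norm (q0 k a)" for k
  proof (rule ccontr)
    assume "\<nexists>a. c < norm (q0 k a)"
    then have "power_sum (p + 1) (q0 k) \<le> c powr (p - 1) * \<nu>"
      using power_sum_le[of "q0 k" "p + 1" c] q0(1)[of k] p by (auto simp: A_def not_less)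
    then have "power_sum (p + 1) (q0 k) / (p + 1) \<le> - I / 2"
      using p unfolding c(2) by (simp add: \<delta>_def field_simps)
    then have "I / 2 \<le> H (q0 k)" using H_ge[of "q0 k"] by linarith
    moreover have "(- I / 2) / real (Suc k) \<le> - I / 2"
      using I_neg by (simp add: field_simps mult_nonpos_nonneg)
    ultimately show False using q0(2)[of k] by linarith
  qed
  then obtain a where a: "\<And>k. c < norm (q0 k (a k))" by metis
  \<comment> \<open>Recentring puts a large amplitude at the site 0, where it survives in the
    pointwise limit.\<close>
  define q1 where "q1 = (\<lambda>k n. q0 k (n + a k))"
  have q1: "square_summable (q1 k)" "square_sum (q1 k) = \<nu>" "H (q1 k) = H (q0 k)"
    "c < norm (q1 k 0)" for k
    using q0(1)[of k] a[of k]
    by (simp_all add: q1_def A_def square_summable_translate square_sum_translate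
        H_def energy_functional_def energy_translate power_sum_translate)
  have "norm (q1 k n) \<le> sqrt \<nu>" for k n
    using norm_le_sqrt_square_sum[OF q1(1), of k n] q1(2) by simp
  \<comment> \<open>Diagonal extraction: countably many sites, with values in a fixed disc.\<close>
  then obtain \<sigma> where \<sigma>: "strict_mono (\<sigma> :: nat \<Rightarrow> nat)" "\<forall>n. \<exists>l. (\<lambda>k. q1 (\<sigma> k) n) \<longlonglongrightarrow> l"
    using function_convergent_subsequence[of "UNIV :: 'a set" q1 "sqrt \<nu>", OF countableI_type]
    by (metis UNIV_I)
  then obtain v where lim: "\<And>n. (\<lambda>k. q1 (\<sigma> k) n) \<longlonglongrightarrow> v n" by metis
  define q where "q = (\<lambda>k. q1 (\<sigma> k))"
  have q: "\<And>k. square_summable (q k)" "\<And>k. square_sum (q k) = \<nu>" "\<And>n. (\<lambda>k. q k n) \<longlonglongrightarrow> v n"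
    using q1 lim by (simp_all add: q_def)
  have C: "square_sum (q k) \<le> \<nu>" for k using q(2) by simp
  note v = square_summable_limit[OF q(1) C q(3)]
  define \<mu> where "\<mu> = square_sum v"
  have "c \<le> norm (v 0)"
    by (rule LIMSEQ_le_const[OF tendsto_norm[OF q(3)]])
      (use q1(4) in \<open>auto simp: q_def intro: less_imp_le\<close>)
  then have "0 < (norm (v 0))\<^sup>2" using c(1) by auto
  also have "\<dots> \<le> \<mu>" unfolding \<mu>_def by (rule norm_square_le_infsum[OF v(1)])
  finally have \<mu>: "0 < \<mu>" "\<mu> \<le> \<nu>" using v(2) by (simp_all add: \<mu>_def)

  define r where "r = (\<lambda>k n. q k n - v n)"
  have r: "square_summable (r k)" for k
    unfolding r_def by (rule square_summable_diff[OF q(1) v(1)])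
  have "(\<lambda>k. (I + (- I / 2) / real (Suc k))) \<longlonglongrightarrow> I + 0"
    by (intro tendsto_add tendsto_const LIMSEQ_Suc[OF lim_const_over_n])
  then have "(\<lambda>k. H (q0 k)) \<longlonglongrightarrow> I"
    using q0 I_le by (intro tendsto_sandwich[OF _ _ tendsto_const[of I], of "\<lambda>k. H (q0 k)"])
      (auto simp: A_def intro!: always_eventually less_imp_le)
  from LIMSEQ_subseq_LIMSEQ[OF this \<sigma>(1)] have "(\<lambda>k. H (q k)) \<longlonglongrightarrow> I"
    by (simp add: q_def q1(3) o_def)
  moreover have "(\<lambda>k. H (q k) - H (r k)) \<longlonglongrightarrow> H v"
    unfolding H_def r_def by (rule energy_functional_split[OF q(1) v(1) C q(3) p])
  ultimately have H_r: "(\<lambda>k. H (r k)) \<longlonglongrightarrow> I - H v"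
    using tendsto_diff[of "\<lambda>k. H (q k)" I sequentially "\<lambda>k. H (q k) - H (r k)" "H v"] by simp
  have "(\<lambda>k. square_sum (q k) - square_sum (r k)) \<longlonglongrightarrow> \<mu>"
    unfolding r_def \<mu>_def using q(1) v(1) unfolding square_summable_def
    by (intro square_sum_split(1)[OF _ _ C q(3)])
  from tendsto_diff[OF tendsto_const[of \<nu>] this] have m_r: "(\<lambda>k. square_sum (r k)) \<longlonglongrightarrow> \<nu> - \<mu>"
    by (simp add: q(2))
  \<comment> \<open>The scaling inequality needs mass at most \<open>\<nu>\<close>. This holds
    eventually because the remainder masses tend to \<open>\<nu> - \<mu> < \<nu>\<close>.\<close>
  have "\<forall>\<^sub>F k in sequentially. square_sum (r k) / \<nu> * I \<le> H (r k)"
  proof (rule eventually_mono)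
    show "\<forall>\<^sub>F k in sequentially. square_sum (r k) < \<nu>"
      using \<mu> by (intro order_tendstoD(2)[OF m_r]) simp
    fix k assume "square_sum (r k) < \<nu>"
    then show "square_sum (r k) / \<nu> * I \<le> H (r k)"
      unfolding H_def
      by (intro energy_functional_ge(1)[OF r p \<nu> _ I_le[unfolded H_def]] less_imp_le)
  qed
  moreover have "(\<lambda>k. square_sum (r k) / \<nu> * I) \<longlonglongrightarrow> (\<nu> - \<mu>) / \<nu> * I"
    using \<nu> by (intro tendsto_intros m_r) auto
  ultimately have "(\<nu> - \<mu>) / \<nu> * I \<le> I - H v"
    by (intro tendsto_le[OF _ H_r]) auto
  then have H_v: "H v \<le> \<mu> / \<nu> * I"
    using \<nu> by (simp add: field_simps)
  have "\<mu> = \<nu>"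
  proof (rule ccontr)
    assume "\<mu> \<noteq> \<nu>"
    then have "\<mu> / \<nu> * I < H v"
      using energy_functional_ge(2)[OF v(1) p \<nu> v(2) I_le[unfolded H_def]] \<mu>
      by (simp add: \<mu>_def H_def)
    then show False using H_v by simp
  qed
  then show ?thesis
    using that[of v] v(1) H_v I_le \<nu> by (force simp: \<mu>_def H_def)
qed

subsection \<open>Moments of admissible kernels\<close>

lemma l1_norm_zero: "l1_norm 0 = 0"
  by (simp add: l1_norm_def)

lemma l1_norm_minus: "l1_norm (- n) = l1_norm n"
  by (simp add: l1_norm_def)

lemma component_le_l1_norm: "\<bar>n $ i\<bar> \<le> int (l1_norm n)"
proof -
  have "nat \<bar>n $ i\<bar> \<le> l1_norm n"
    unfolding l1_norm_def by (rule member_le_sum) auto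
  then show ?thesis by simp
qed

lemma l1_norm_eq_0_iff: "l1_norm n = 0 \<longleftrightarrow> n = 0"
  by (simp add: l1_norm_def vec_eq_iff)

lemma l1_norm_triangle: "l1_norm (n + m) \<le> l1_norm n + l1_norm m"
  unfolding l1_norm_def sum.distrib[symmetric] by (rule sum_mono) auto

lemma l1_norm_triangle_diff: "\<bar>real (l1_norm n) - real (l1_norm m)\<bar> \<le> real (l1_norm (n - m))"
  using l1_norm_triangle[of "n - m" m] l1_norm_triangle[of "m - n" n] l1_norm_minus[of "n - m"]
  by (simp add: abs_le_iff)

text \<open>A sup-norm cube, whose cardinality is exact. It contains the l1 ball of radius
  \<open>N\<close> and lies in the l1 ball of radius \<open>d * N\<close>.\<close>

definition lattice_box :: "nat \<Rightarrow> (int ^ 'd) set" where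
  "lattice_box N = {n. \<forall>i. n $ i \<in> {- int N..int N}}"

lemma bij_betw_lattice_box: "bij_betw vec_nth (lattice_box N :: (int ^ 'd) set) (PiE UNIV (\<lambda>_. {- int N..int N}))"
  by (rule bij_betwI[where g = vec_lambda]) (auto simp: lattice_box_def PiE_def Pi_def)

lemma finite_lattice_box: "finite (lattice_box N :: (int ^ 'd) set)"
  using bij_betw_finite[OF bij_betw_lattice_box[of N]] by (simp add: finite_PiE)

lemma card_lattice_box: "card (lattice_box N :: (int ^ 'd) set) = (2 * N + 1) ^ CARD('d)"
proof -
  have "card {- int N..int N} = 2 * N + 1" by (simp add: nat_eq_iff)
  then show ?thesis
    using bij_betw_same_card[OF bij_betw_lattice_box[of N, where 'd = 'd]] by (simp add: card_PiE)
qed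

text \<open>\<open>max 1\<close> gives the value 1 at 0, where \<open>powr\<close> alone would
  return 0; otherwise a vector with one vanishing component would get the product bound 0.\<close>

lemma summable_on_int_powr:
  assumes "\<delta> > 0"
  shows "(\<lambda>k::int. max 1 (real_of_int \<bar>k\<bar>) powr - (1 + \<delta>)) summable_on UNIV" (is "?\<phi> summable_on _")
proof -
  have "summable (\<lambda>n. real n powr - (1 + \<delta>))"
    unfolding summable_real_powr_iff using assms by simp
  then have "summable (\<lambda>n. max 1 (real n) powr - (1 + \<delta>))"
    by (subst summable_cong[where g = "\<lambda>n. real n powr - (1 + \<delta>)"])
      (auto simp: eventually_sequentially intro!: exI[of _ 1])
  then have nat: "(\<lambda>n. max 1 (real n) powr - (1 + \<delta>)) summable_on (UNIV :: nat set)"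
    by (rule summable_nonneg_imp_summable_on) simp
  have "?\<phi> summable_on range int" "?\<phi> summable_on range (\<lambda>n. - int n)"
    using nat by (subst summable_on_reindex; simp add: inj_on_def o_def)+
  then have "?\<phi> summable_on (range int \<union> range (\<lambda>n. - int n))"
    by (rule summable_on_union)
  moreover have "range int \<union> range (\<lambda>n. - int n) = UNIV"
    by (auto intro: int_cases2)
  ultimately show ?thesis by simp
qed

text \<open>Since \<open>|n|\<close> dominates each \<open>max 1 |n\<^sub>i|\<close>, the power \<open>|n|\<^bsup>-(d+\<epsilon>)\<^esup>\<close> is bounded by a product of
  one-dimensional summable functions; no count of the spheres is needed.\<close>

lemma summable_on_l1_norm_powr:
  assumes "\<epsilon> > 0"
  shows "(\<lambda>n :: int ^ 'd. real (l1_norm n) powr - (real CARD('d) + \<epsilon>)) summable_on UNIV"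
proof -
  \<comment> \<open>The surplus exponent is shared equally among the coordinates.\<close>
  define \<delta> where "\<delta> = \<epsilon> / real CARD('d)"
  define \<phi> where "\<phi> = (\<lambda>k::int. max 1 (real_of_int \<bar>k\<bar>) powr - (1 + \<delta>))"
  have \<delta>: "\<delta> > 0" using assms by (simp add: \<delta>_def)
  have \<phi>: "\<phi> summable_on UNIV" unfolding \<phi>_def by (rule summable_on_int_powr[OF \<delta>])
  have \<phi>_nonneg: "0 \<le> \<phi> k" for k by (simp add: \<phi>_def)
  have le: "real (l1_norm n) powr - (real CARD('d) + \<epsilon>) \<le> (\<Prod>i\<in>UNIV. \<phi> (n $ i))" for n :: "int ^ 'd"
  proof (cases "n = 0")
    case False
    then have pos: "1 \<le> l1_norm n" using l1_norm_eq_0_iff[of n] by simp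
    have "- (real CARD('d) + \<epsilon>) = - (1 + \<delta>) * real CARD('d)" by (simp add: \<delta>_def field_simps)
    then have "real (l1_norm n) powr - (real CARD('d) + \<epsilon>)
        = (real (l1_norm n) powr - (1 + \<delta>)) powr real CARD('d)"
      by (simp only: powr_powr)
    also have "\<dots> = (\<Prod>i\<in>(UNIV :: 'd set). real (l1_norm n) powr - (1 + \<delta>))"
      using pos by (simp add: powr_realpow)
    also have "\<dots> \<le> (\<Prod>i\<in>UNIV. \<phi> (n $ i))"
    proof (rule prod_mono)
      fix i
      have "real_of_int \<bar>n $ i\<bar> \<le> real (l1_norm n)"
        using component_le_l1_norm[of n i] by linarith
      then show "0 \<le> real (l1_norm n) powr - (1 + \<delta>) \<and> real (l1_norm n) powr - (1 + \<delta>) \<le> \<phi> (n $ i)"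
        unfolding \<phi>_def using pos \<delta> by (auto intro!: powr_mono2')
    qed
    finally show ?thesis .
  qed (simp add: l1_norm_zero prod_nonneg \<phi>_nonneg)
  show ?thesis
  proof (rule nonneg_bdd_above_summable_on)
    show "bdd_above (sum (\<lambda>n :: int ^ 'd. real (l1_norm n) powr - (real CARD('d) + \<epsilon>)) `
        {F. F \<subseteq> UNIV \<and> finite F})"
    proof (rule bdd_aboveI2)
      fix F :: "(int ^ 'd) set" assume "F \<in> {F. F \<subseteq> UNIV \<and> finite F}"
      then have F: "finite F" by simp
      \<comment> \<open>All coordinate values met in \<open>F\<close>: enlarging \<open>F\<close> to
        the full power of \<open>G\<close> lets the sum factor over the coordinates.\<close>
      define G where "G = (\<Union>i. (\<lambda>n. n $ i) ` F)"
      have G: "finite G" using F by (simp add: G_def)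
      have "(\<Sum>n\<in>F. real (l1_norm n) powr - (real CARD('d) + \<epsilon>)) \<le> (\<Sum>n\<in>F. \<Prod>i\<in>UNIV. \<phi> (n $ i))"
        by (rule sum_mono[OF le])
      also have "\<dots> = (\<Sum>f\<in>vec_nth ` F. \<Prod>i\<in>UNIV. \<phi> (f i))"
        by (subst sum.reindex) (auto simp: inj_on_def vec_nth_inject)
      also have "\<dots> \<le> (\<Sum>f\<in>PiE (UNIV :: 'd set) (\<lambda>_. G). \<Prod>i\<in>UNIV. \<phi> (f i))"
        by (intro sum_mono2 finite_PiE) (use G in \<open>auto simp: G_def PiE_def prod_nonneg \<phi>_nonneg\<close>)
      also have "\<dots> = (\<Prod>i\<in>(UNIV :: 'd set). \<Sum>k\<in>G. \<phi> k)"
        using G by (intro prod_sum_PiE[symmetric]) auto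
      also have "\<dots> \<le> (\<Prod>i\<in>(UNIV :: 'd set). infsum \<phi> UNIV)"
        using G by (intro prod_mono conjI finite_sum_le_infsum \<phi>) (auto simp: \<phi>_nonneg sum_nonneg)
      finally show "(\<Sum>n\<in>F. real (l1_norm n) powr - (real CARD('d) + \<epsilon>)) \<le> infsum \<phi> UNIV ^ CARD('d)"
        by simp
    qed
  qed simp
qed

text \<open>Unifies the two kinds of tail: the rate is the tail index itself when finite, and
  \<open>s + 1\<close> when it is infinite.\<close>

lemma envelope_decay:
  assumes "envelope d \<alpha> \<eta>" "ereal s < \<alpha>"
  obtains \<beta> C :: real and k0 :: nat where "s < \<beta>" "\<And>k. k \<ge> k0 \<Longrightarrow> real k powr (real d + \<beta>) * \<eta> k \<le> C"
proof (cases "\<alpha> = \<infinity>")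
  case True
  then have "(\<lambda>k. real k powr (real d + (s + 1)) * \<eta> k) \<longlonglongrightarrow> 0"
    using assms(1) unfolding envelope_def by blast
  from order_tendstoD(2)[OF this, of 1] obtain k0
    where "\<And>k. k \<ge> k0 \<Longrightarrow> real k powr (real d + (s + 1)) * \<eta> k < 1"
    by (auto simp: eventually_sequentially)
  then show ?thesis by (intro that[of "s + 1" k0 1]) (auto intro: less_imp_le)
next
  case False
  then obtain a where a: "\<alpha> = ereal a" "s < a" using assms(2) by (cases \<alpha>) auto
  then have "\<alpha> < \<infinity>" by simp
  then obtain C k0 where "\<forall>k\<ge>k0. real k powr (real d + real_of_ereal \<alpha>) * \<eta> k \<le> C"
    using assms(1) unfolding envelope_def by blast
  then show ?thesis using a by (intro that[of a k0 C]) auto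
qed

text \<open>Far out the summand is at most a multiple of |n|^(-(d + \<beta> - s)) with \<beta> > s;
  only finitely many sites remain.\<close>

lemma admissible_kernel_moment_summable:
  fixes J :: "int ^ 'd \<Rightarrow> real"
  assumes "admissible_kernel \<alpha> J" "ereal s < \<alpha>"
  shows "(\<lambda>n. J n * real (l1_norm n) powr s) summable_on UNIV"
proof -
  from assms(1) obtain \<eta> R c where \<eta>: "envelope CARD('d) \<alpha> \<eta>"
    and c: "\<forall>n. R \<le> real (l1_norm n) \<longrightarrow> J n \<le> c * \<eta> (l1_norm n)" "0 < c"
    and J: "\<forall>n. 0 \<le> J n"
    unfolding admissible_kernel_def by (elim conjE exE) (rule that)
  obtain \<beta> C k0 where \<beta>: "s < \<beta>"
    and C: "\<And>k. k \<ge> k0 \<Longrightarrow> real k powr (real CARD('d) + \<beta>) * \<eta> k \<le> C"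
    by (rule envelope_decay[OF \<eta> assms(2)]) (rule that)
  \<comment> \<open>The entry 1 keeps the norm positive outside \<open>B\<close>, so that its powers
    can be divided by.\<close>
  define K where "K = Max {k0, nat \<lceil>R\<rceil>, 1}"
  have K: "k0 \<le> K" "R \<le> real K" "1 \<le> K"
    unfolding K_def by (auto simp: le_max_iff_disj) linarith
  define B where "B = {n :: int ^ 'd. l1_norm n < K}"
  have "B = (\<Union>k<K. l1_sphere k)" by (auto simp: B_def l1_sphere_def)
  then have "finite B" by (simp add: finite_l1_sphere)
  have "(\<lambda>n. J n * real (l1_norm n) powr s) summable_on - B"
  proof (rule summable_on_comparison_test)
    show "(\<lambda>n :: int ^ 'd. c * C * real (l1_norm n) powr - (real CARD('d) + (\<beta> - s))) summable_on - B"
      using summable_on_l1_norm_powr[of "\<beta> - s", where 'd = 'd] \<beta>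
      by (intro summable_on_cmult_right) (auto intro: summable_on_subset_banach)
    fix n assume "n \<in> - B"
    then have n: "K \<le> l1_norm n" by (auto simp: B_def)
    define x where "x = real (l1_norm n)"
    have x: "x > 0" "R \<le> x" using K n by (auto simp: x_def)
    have "J n \<le> c * \<eta> (l1_norm n)" using c(1) x by (simp add: x_def)
    also have "\<eta> (l1_norm n) \<le> C * x powr - (real CARD('d) + \<beta>)"
    proof -
      have "x powr (real CARD('d) + \<beta>) * \<eta> (l1_norm n) \<le> C"
        using C[of "l1_norm n"] K n by (simp add: x_def)
      moreover have "0 < x powr (real CARD('d) + \<beta>)" using x by simp
      ultimately have "\<eta> (l1_norm n) \<le> C / x powr (real CARD('d) + \<beta>)"
        by (simp add: pos_le_divide_eq mult.commute)
      then show ?thesis by (simp only: powr_minus_divide times_divide_eq_right mult_1_right)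
    qed
    finally have "J n * x powr s \<le> c * (C * x powr - (real CARD('d) + \<beta>)) * x powr s"
      using c(2) by (intro mult_right_mono) auto
    also have "x powr - (real CARD('d) + \<beta>) * x powr s = x powr - (real CARD('d) + (\<beta> - s))"
      unfolding powr_add[symmetric] by (simp add: algebra_simps)
    then have "c * (C * x powr - (real CARD('d) + \<beta>)) * x powr s
        = c * C * x powr - (real CARD('d) + (\<beta> - s))"
      by (simp add: mult.assoc)
    finally show "J n * real (l1_norm n) powr s \<le> c * C * real (l1_norm n) powr - (real CARD('d) + (\<beta> - s))"
      by (simp add: x_def)
  qed (use J in auto)
  then have "(\<lambda>n. J n * real (l1_norm n) powr s) summable_on (B \<union> - B)"
    using \<open>finite B\<close> by (intro summable_on_union) auto
  then show ?thesis by simp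
qed

subsection \<open>Tent functions\<close>

text \<open>For \<open>N = 0\<close> division by zero would make this the constant 1; hence
  \<open>N > 0\<close> in the estimates.\<close>

definition tent :: "nat \<Rightarrow> int ^ 'd \<Rightarrow> complex" where
  "tent N n = complex_of_real (max 0 (1 - real (l1_norm n) / real N))"

lemma norm_tent: "norm (tent N n) = max 0 (1 - real (l1_norm n) / real N)"
  by (simp add: tent_def)

lemma tent_outside_box:
  assumes "N > 0" "n \<notin> lattice_box N"
  shows "tent N n = 0"
proof -
  obtain i where "n $ i \<notin> {- int N..int N}" using assms(2) by (auto simp: lattice_box_def)
  then have "int N < int (l1_norm n)"
    using component_le_l1_norm[of n i] by auto
  then show ?thesis using assms(1) by (simp add: tent_def)
qed

text \<open>The increment is at most 1 and at most the scaled distance \<open>x\<close>; the first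
  bound serves \<open>x > 1\<close>, the second \<open>x \<le> 1\<close>.\<close>

lemma norm_tent_diff_square_le:
  assumes N: "N > 0" and s: "0 < s" "s \<le> 2"
  shows "(norm (tent N n - tent N m))\<^sup>2 \<le> real N powr - s * real (l1_norm (n - m)) powr s"
proof -
  define x where "x = real (l1_norm (n - m)) / real N"
  define D where "D = norm (tent N n - tent N m)"
  define a b where "a = real (l1_norm n) / real N" and "b = real (l1_norm m) / real N"
  have D: "D = \<bar>max 0 (1 - a) - max 0 (1 - b)\<bar>"
    unfolding D_def tent_def a_def b_def of_real_diff[symmetric] norm_of_real ..
  have "\<bar>a - b\<bar> \<le> x"
    using l1_norm_triangle_diff[of n m] N
    unfolding a_def b_def x_def diff_divide_distrib[symmetric] by (simp add: divide_right_mono)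
  moreover have "0 \<le> a" "0 \<le> b" by (simp_all add: a_def b_def)
  ultimately have "D \<le> x" "D \<le> 1" "0 \<le> D" unfolding D by (auto simp: max_def)
  have "D\<^sup>2 \<le> x powr s"
  proof (cases "x \<le> 1")
    case True
    have "D\<^sup>2 \<le> x\<^sup>2" using \<open>D \<le> x\<close> \<open>0 \<le> D\<close> by (rule power_mono)
    also have "\<dots> = x powr 2" using \<open>D \<le> x\<close> \<open>0 \<le> D\<close> by simp
    also have "\<dots> \<le> x powr s"
      using True s \<open>D \<le> x\<close> \<open>0 \<le> D\<close> by (intro powr_mono') auto
    finally show ?thesis .
  next
    case False
    have "D\<^sup>2 \<le> 1" using \<open>D \<le> 1\<close> \<open>0 \<le> D\<close> by (simp add: power_le_one)
    also have "1 \<le> x powr s" using False s by (intro ge_one_powr_ge_zero) auto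
    finally show ?thesis .
  qed
  also have "x powr s = real N powr - s * real (l1_norm (n - m)) powr s"
    by (simp add: x_def powr_divide powr_minus_divide)
  finally show ?thesis by (simp add: D_def)
qed

lemma has_sum_indicator:
  assumes "finite B"
  shows "((indicator B :: 'a \<Rightarrow> real) has_sum real (card B)) UNIV"
  using assms has_sum_finite_neutralI[of B UNIV "indicator B :: 'a \<Rightarrow> real"]
  by (auto simp: indicator_def)

lemma
  assumes N: "N > 0"
  shows square_summable_tent: "square_summable (tent N :: int ^ 'd \<Rightarrow> complex)"
    and square_sum_tent_le: "square_sum (tent N :: int ^ 'd \<Rightarrow> complex) \<le> real ((2 * N + 1) ^ CARD('d))"
proof -
  let ?B = "lattice_box N :: (int ^ 'd) set"
  note B = has_sum_indicator[OF finite_lattice_box[of N, where 'd = 'd]]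
  have le: "(norm (tent N n))\<^sup>2 \<le> indicator ?B n" for n
    by (cases "n \<in> ?B") (simp_all add: tent_outside_box[OF N] norm_tent power_le_one)
  show *: "square_summable (tent N :: int ^ 'd \<Rightarrow> complex)"
    unfolding square_summable_def
    by (rule summable_on_comparison_test[OF has_sum_imp_summable[OF B]]) (use le in auto)
  have "square_sum (tent N :: int ^ 'd \<Rightarrow> complex) \<le> infsum (indicator ?B) UNIV"
    by (rule infsum_mono[OF *[unfolded square_summable_def] has_sum_imp_summable[OF B]])
      (use le in auto)
  then show "square_sum (tent N :: int ^ 'd \<Rightarrow> complex) \<le> real ((2 * N + 1) ^ CARD('d))"
    unfolding infsumI[OF B] card_lattice_box .
qed

text \<open>On the cube of half-side \<open>L\<close> the l1 norm is at most \<open>d * L\<close>,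
  half the radius of the tent, so the tent is at least 1/2 there.\<close>

lemma power_sum_tent_ge:
  assumes L: "L > 0" and s: "2 \<le> s"
  shows "real ((2 * L + 1) ^ CARD('d)) * (1 / 2) powr s
    \<le> power_sum s (tent (2 * CARD('d) * L) :: int ^ 'd \<Rightarrow> complex)"
proof -
  define N where "N = 2 * CARD('d) * L"
  have N: "N > 0" using L by (simp add: N_def)
  let ?B = "lattice_box L :: (int ^ 'd) set"
  have half: "1 / 2 \<le> norm (tent N n)" if "n \<in> ?B" for n
  proof -
    have "nat \<bar>n $ i\<bar> \<le> L" for i
    proof -
      have "n $ i \<in> {- int L..int L}" using that by (simp add: lattice_box_def)
      then show ?thesis by auto
    qed
    then have "l1_norm n \<le> (\<Sum>i\<in>(UNIV :: 'd set). L)"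
      unfolding l1_norm_def by (intro sum_mono)
    then have "l1_norm n \<le> CARD('d) * L" by simp
    then have "real (l1_norm n) \<le> real (CARD('d) * L)" by (simp only: of_nat_le_iff)
    then have "1 / 2 \<le> 1 - real (l1_norm n) / real N"
      using N by (simp add: N_def field_simps)
    then show ?thesis unfolding norm_tent by (rule max.coboundedI2)
  qed
  have "real (card ?B) * (1 / 2) powr s = (\<Sum>n\<in>?B. (1 / 2) powr s)" by simp
  also have "\<dots> \<le> (\<Sum>n\<in>?B. norm (tent N n) powr s)"
    using half s by (intro sum_mono powr_mono2) auto
  also have "\<dots> \<le> power_sum s (tent N :: int ^ 'd \<Rightarrow> complex)"
    unfolding power_sum_def
    by (intro finite_sum_le_infsum power_summable square_summable_tent N s finite_lattice_box) auto
  finally show ?thesis by (simp add: card_lattice_box N_def)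
qed

text \<open>A pair contributes only if one of its sites lies in the box, so the two indicators sum
  to at least 1. The resulting two convolution sums are compensated by the factor 1/2 in
  \<open>energy\<close>.\<close>

lemma energy_tent_le:
  fixes J :: "int ^ 'd \<Rightarrow> real"
  assumes N: "N > 0" and s: "0 < s" "s \<le> 2" and J: "summable_kernel J"
    and W: "(\<lambda>n. J n * real (l1_norm n) powr s) summable_on UNIV"
  shows "energy J (tent N)
    \<le> real N powr - s * (\<Sum>\<^sub>\<infinity>n. J n * real (l1_norm n) powr s) * real ((2 * N + 1) ^ CARD('d))"
proof -
  interpret summable_kernel J by (rule J)
  define K where "K = (\<lambda>n. J n * real (l1_norm n) powr s)"
  let ?w = "indicator (lattice_box N) :: int ^ 'd \<Rightarrow> real"
  define S where "S = infsum K UNIV * real ((2 * N + 1) ^ CARD('d))"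
  have K: "0 \<le> K n" for n by (simp add: K_def J_nonneg)
  have w: "(?w has_sum real ((2 * N + 1) ^ CARD('d))) UNIV"
    using has_sum_indicator[OF finite_lattice_box[of N, where 'd = 'd]] unfolding card_lattice_box .
  define f where "f = (\<lambda>(n, m). real N powr - s * (K (n - m) * ?w n + K (n - m) * ?w m))"
  have f: "(f has_sum (real N powr - s * (S + S))) UNIV"
    using has_sum_cmult_right[OF has_sum_add[OF
        has_sum_convolution1[OF W[folded K_def] K has_sum_imp_summable[OF w] indicator_pos_le]
        has_sum_convolution2[OF W[folded K_def] K has_sum_imp_summable[OF w] indicator_pos_le]],
        of "real N powr - s"]
    unfolding infsumI[OF w] by (simp add: f_def S_def case_prod_unfold)
  have le: "(\<lambda>(n, m). J (n - m) * (norm (tent N n - tent N m))\<^sup>2) x \<le> f x" for x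
  proof -
    obtain n m where x: "x = (n, m)" by force
    show ?thesis
    proof (cases "n \<in> lattice_box N \<or> m \<in> lattice_box N")
      case True
      then have one: "1 \<le> ?w n + ?w m" by (auto simp: indicator_def)
      have "J (n - m) * (norm (tent N n - tent N m))\<^sup>2
          \<le> J (n - m) * (real N powr - s * real (l1_norm (n - m)) powr s)"
        by (intro mult_left_mono norm_tent_diff_square_le N s J_nonneg)
      also have "\<dots> = real N powr - s * K (n - m) * 1" by (simp add: K_def)
      also have "\<dots> \<le> real N powr - s * K (n - m) * (?w n + ?w m)"
        using K by (intro mult_left_mono one) auto
      finally show ?thesis by (simp add: x f_def algebra_simps)
    next
      case False
      then show ?thesis using K by (simp add: x f_def tent_outside_box[OF N])
    qed
  qed
  have "(\<Sum>\<^sub>\<infinity>(n, m). J (n - m) * (norm (tent N n - tent N m))\<^sup>2) \<le> infsum f UNIV"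
    using le by (intro infsum_mono energy_summable square_summable_tent N has_sum_imp_summable[OF f])
  then show ?thesis
    unfolding infsumI[OF f] by (simp add: energy_def S_def K_def)
qed

text \<open>Used twice: with arbitrary \<open>\<epsilon>\<close> for the vanishing of the infimum,
  and with one value depending on the mass for negative energy.\<close>

lemma small_energy_quotient:
  fixes J :: "int ^ 'd \<Rightarrow> real"
  assumes p: "p > 1" and J: "summable_kernel J"
    and s: "real CARD('d) * (p - 1) / 2 < s" "s \<le> 2"
    and W: "(\<lambda>n. J n * real (l1_norm n) powr s) summable_on UNIV" and \<epsilon>: "\<epsilon> > 0"
  obtains u where "square_summable u" "u \<noteq> (\<lambda>_. 0)"
    "square_sum u powr ((p - 1) / 2) * energy J u < \<epsilon> * power_sum (p + 1) u"
proof -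
  interpret summable_kernel J by (rule J)
  define d where "d = CARD('d)"
  define w where "w = (\<Sum>\<^sub>\<infinity>n. J n * real (l1_norm n) powr s)"
  define a where "a = real d * (p - 1) / 2 - s"
  \<comment> \<open>The factors 3 come from \<open>2 * N + 1 \<le> 3 * N\<close>. In
    \<open>\<epsilon>'\<close>, dividing by \<open>real d ^ d\<close> converts \<open>x ^ d\<close>
    into \<open>real (2 * L) ^ d\<close>, and the power of 1/2 is the lower bound for the
    tent.\<close>
  define C where "C = 3 powr (real d * (p - 1) / 2) * w * 3 ^ d"
  define \<epsilon>' where "\<epsilon>' = \<epsilon> / real d ^ d * (1 / 2) powr (p + 1)"
  have d: "d > 0" by (simp add: d_def)
  have s0: "0 < s"
    using s(1) p by (smt (verit, best) divide_nonneg_nonneg mult_nonneg_nonneg of_nat_0_le_iff)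
  have w: "0 \<le> w" unfolding w_def by (intro infsum_nonneg) (simp add: J_nonneg)
  have "a < 0" using s by (simp add: a_def d_def)
  have "((\<lambda>x. C * x powr a) \<longlongrightarrow> C * 0) at_top"
    using \<open>a < 0\<close> by (intro tendsto_intros tendsto_neg_powr filterlim_ident)
  moreover have "filterlim (\<lambda>L. real (2 * d * L)) at_top sequentially"
    using d by (intro filterlim_compose[OF filterlim_real_sequentially] filterlim_subseq)
      (auto simp: strict_mono_def)
  ultimately have "(\<lambda>L. C * real (2 * d * L) powr a) \<longlonglongrightarrow> 0"
    by (auto dest: filterlim_compose)
  moreover have "0 < \<epsilon>'" using \<epsilon> d by (simp add: \<epsilon>'_def)
  ultimately obtain L0 where L0: "\<And>L. L \<ge> L0 \<Longrightarrow> C * real (2 * d * L) powr a < \<epsilon>'"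
    using order_tendstoD(2)[of "\<lambda>L. C * real (2 * d * L) powr a" 0 sequentially \<epsilon>']
    by (auto simp: eventually_sequentially)
  define L where "L = max L0 1"
  define N where "N = 2 * d * L"
  define x where "x = real N"
  have L: "L > 0" "L0 \<le> L" by (auto simp: L_def)
  have N: "N > 0" using L d by (simp add: N_def)
  have x: "x \<ge> 1" "x > 0" using N by (auto simp: x_def)
  let ?u = "tent N :: int ^ 'd \<Rightarrow> complex"
  have u: "square_summable ?u" by (rule square_summable_tent[OF N])
  have "?u 0 \<noteq> 0" using N by (simp add: tent_def l1_norm_zero)
  then have u0: "?u \<noteq> (\<lambda>_. 0)" by metis
  have box_le: "real ((2 * N + 1) ^ d) \<le> (3 * x) ^ d"
    unfolding of_nat_power using x by (intro power_mono) (auto simp: x_def)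
  have ss: "0 \<le> square_sum ?u" by (rule infsum_nonneg) simp
  have "square_sum ?u powr ((p - 1) / 2) \<le> ((3 * x) ^ d) powr ((p - 1) / 2)"
    using order_trans[OF square_sum_tent_le[OF N, where 'd = 'd, folded d_def] box_le] ss p
    by (intro powr_mono2) auto
  also have "\<dots> = ((3 * x) powr real d) powr ((p - 1) / 2)"
    using x by (simp add: powr_realpow)
  also have "\<dots> = (3 * x) powr (real d * (p - 1) / 2)"
    by (simp add: powr_powr)
  finally have 1: "square_sum ?u powr ((p - 1) / 2) \<le> (3 * x) powr (real d * (p - 1) / 2)" .
  have "energy J ?u \<le> x powr - s * w * real ((2 * N + 1) ^ d)"
    using energy_tent_le[OF N s0 s(2) J W] by (simp only: w_def x_def d_def)
  also have "\<dots> \<le> x powr - s * w * (3 * x) ^ d"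
    using w by (intro mult_left_mono box_le) auto
  finally have 2: "energy J ?u \<le> x powr - s * w * (3 * x) ^ d" .
  have "square_sum ?u powr ((p - 1) / 2) * energy J ?u
      \<le> (3 * x) powr (real d * (p - 1) / 2) * (x powr - s * w * (3 * x) ^ d)"
    using 1 2 energy_nonneg by (intro mult_mono) auto
  also have "\<dots> = 3 powr (real d * (p - 1) / 2) * w * 3 ^ d
      * (x powr (real d * (p - 1) / 2) * x powr - s) * x ^ d"
    using x by (simp add: powr_mult power_mult_distrib)
  also have "x powr (real d * (p - 1) / 2) * x powr - s = x powr a"
    unfolding powr_add[symmetric] by (simp add: a_def)
  finally have "square_sum ?u powr ((p - 1) / 2) * energy J ?u \<le> C * x powr a * x ^ d"
    by (simp only: C_def)
  also have "\<dots> < \<epsilon>' * x ^ d"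
    using L0[OF L(2)] x by (intro mult_strict_right_mono) (auto simp: x_def N_def)
  also have "\<epsilon>' * x ^ d = \<epsilon> * (real (2 * L) ^ d * (1 / 2) powr (p + 1))"
  proof -
    have "x ^ d = real d ^ d * real (2 * L) ^ d"
      unfolding power_mult_distrib[symmetric] by (simp add: x_def N_def mult_ac)
    then show ?thesis using d by (simp add: \<epsilon>'_def)
  qed
  also have "\<dots> \<le> \<epsilon> * (real ((2 * L + 1) ^ d) * (1 / 2) powr (p + 1))"
    unfolding of_nat_power using \<epsilon>
    by (intro mult_left_mono mult_right_mono power_mono) auto
  also have "\<dots> \<le> \<epsilon> * power_sum (p + 1) ?u"
    using power_sum_tent_ge[OF L(1), of "p + 1", where 'd = 'd] p \<epsilon>
    by (intro mult_left_mono) (auto simp: N_def d_def)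
  finally show ?thesis using that[OF u u0] by simp
qed

subsection \<open>The lattice model\<close>

lemma lp_space_2_iff: "u \<in> lp_space 2 \<longleftrightarrow> square_summable u"
  by (simp add: lp_space_def square_summable_def)

lemma mass_eq_square_sum: "mass u = square_sum u"
  using infsum_nonneg[of UNIV "\<lambda>n. (norm (u n))\<^sup>2"]
  by (simp add: mass_def lp_norm_def powr_half_sqrt)

lemma lp_norm_2_powr: "lp_norm 2 u powr r = square_sum u powr (r / 2)"
  by (simp add: lp_norm_def powr_powr)

lemma lp_norm_powr_self: "r \<noteq> 0 \<Longrightarrow> lp_norm r u powr r = power_sum r u"
  using power_sum_nonneg[of r u] by (simp add: lp_norm_def power_sum_def powr_powr)

lemma admissible_imp_summable_kernel:
  assumes "admissible_kernel \<alpha> J"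
  shows "summable_kernel J"
  using assms unfolding admissible_kernel_def by unfold_locales metis+

lemma lattice_form_eq_energy:
  assumes "summable_kernel J" "square_summable u"
  shows "lattice_form J u = energy J u"
  unfolding lattice_form_def l2_inner_def lattice_op_def
  by (rule summable_kernel.infsum_form_eq_energy[OF assms])

lemma hamiltonian_eq:
  assumes "summable_kernel J" "square_summable u" "p > 1"
  shows "hamiltonian p J u = energy_functional p J u"
  using assms by (simp add: hamiltonian_def energy_functional_def lattice_form_eq_energy lp_norm_powr_self)

theorem proposition3p2:
  fixes J :: "int ^ 'd \<Rightarrow> real" and \<alpha> :: ereal and p :: real
  assumes "p > 1"
    and "admissible_kernel \<alpha> J"
    and "p < 1 + 4 * reduced_index \<alpha> / real CARD('d)"
  shows "GN_const p J = 0 \<and> threshold_mass p J = 0 \<and>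
    (\<forall>\<nu>>0. \<exists>q. is_minimizer p J \<nu> q)"
proof -
  note p = assms(1)
  note J = admissible_imp_summable_kernel[OF assms(2)]
  interpret summable_kernel J by (rule J)
  have \<alpha>: "0 < \<alpha>" using assms(2) unfolding admissible_kernel_def by blast
  define t where "t = real CARD('d) * (p - 1) / 2"
  have t: "t < 2 * reduced_index \<alpha>"
    using assms(3) by (simp add: t_def field_simps)
  obtain s where s: "t < s" "s \<le> 2" "ereal s < \<alpha>"
  proof -
    \<comment> \<open>The midpoint stays strictly below min(\<alpha>, 2), so the moment is finite
      even when \<alpha> = 2.\<close>
    define s where "s = (t + 2 * reduced_index \<alpha>) / 2"
    have s: "t < s" "s < 2 * reduced_index \<alpha>" using t by (auto simp: s_def)
    show ?thesis
    proof (cases "\<alpha> < 2")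
      case True
      then obtain a where a: "\<alpha> = ereal a" "a < 2" using \<alpha> by (cases \<alpha>) auto
      then show ?thesis using True s that[of s] by (simp add: reduced_index_def)
    next
      case False
      then have "s < 2" using s by (simp add: reduced_index_def)
      then have "ereal s < 2" by simp
      also have "2 \<le> \<alpha>" using False by simp
      finally show ?thesis using \<open>s < 2\<close> s that[of s] by simp
    qed
  qed
  note small = small_energy_quotient[OF p J s(1)[unfolded t_def] s(2)
      admissible_kernel_moment_summable[OF assms(2) s(3)]]

  have GN: "GN_const p J = 0"
  proof -
    define Q where "Q = (\<lambda>u. lp_norm 2 u powr (p - 1) * lattice_form J u / lp_norm (p + 1) u powr (p + 1))"
    define U where "U = lp_space 2 - {\<lambda>_ :: int ^ 'd. 0 :: complex}"
    have U: "u \<in> U \<longleftrightarrow> square_summable u \<and> u \<noteq> (\<lambda>_. 0)" for u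
      by (auto simp: U_def lp_space_2_iff)
    have Q: "Q u = square_sum u powr ((p - 1) / 2) * energy J u / power_sum (p + 1) u" if "u \<in> U" for u
      using that p J by (simp add: Q_def U lp_norm_2_powr lp_norm_powr_self lattice_form_eq_energy)
    have Q_nonneg: "0 \<le> Q u" if "u \<in> U" for u
      unfolding Q[OF that]
      by (intro divide_nonneg_nonneg mult_nonneg_nonneg energy_nonneg power_sum_nonneg) auto
    have less: "\<exists>u\<in>U. Q u < \<epsilon>" if \<epsilon>: "\<epsilon> > 0" for \<epsilon>
    proof -
      obtain u where u: "square_summable u" "u \<noteq> (\<lambda>_. 0)"
        "square_sum u powr ((p - 1) / 2) * energy J u < \<epsilon> * power_sum (p + 1) u"
        using small[OF \<epsilon>] by blast
      moreover from u(2) obtain n where "u n \<noteq> 0" by auto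
      then have "0 < power_sum (p + 1) u" using power_sum_pos[OF u(1), of "p + 1"] p by simp
      ultimately have "u \<in> U" "Q u < \<epsilon>" using Q[of u] by (simp_all add: U pos_divide_less_eq)
      then show ?thesis by blast
    qed
    have bdd: "bdd_below (Q ` U)" using Q_nonneg by (rule bdd_belowI2)
    have "U \<noteq> {}" using less[of 1] by auto
    have "(INF u\<in>U. Q u) = 0"
    proof (rule antisym)
      show "(INF u\<in>U. Q u) \<le> 0"
      proof (rule field_le_epsilon)
        fix \<epsilon> :: real assume "\<epsilon> > 0"
        then obtain u where "u \<in> U" "Q u < \<epsilon>" using less by blast
        then show "(INF u\<in>U. Q u) \<le> 0 + \<epsilon>" using cINF_lower[OF bdd, of u] by simp
      qed
      show "0 \<le> (INF u\<in>U. Q u)" using \<open>U \<noteq> {}\<close> Q_nonneg by (rule cINF_greatest)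
    qed
    then show ?thesis by (simp add: GN_const_def Q_def U_def)
  qed
  moreover have "\<exists>q. is_minimizer p J \<nu> q" if \<nu>: "\<nu> > 0" for \<nu>
  proof -
    \<comment> \<open>The critical size of the quotient: below it, rescaling \<open>u\<close> to
      mass \<open>\<nu>\<close> makes the focusing term outweigh the quadratic one.\<close>
    have "0 < 2 / (p + 1) * \<nu> powr ((p - 1) / 2)" using p \<nu> by simp
    from small[OF this] obtain u where u: "square_summable u" "u \<noteq> (\<lambda>_. 0)"
      "square_sum u powr ((p - 1) / 2) * energy J u
        < 2 / (p + 1) * \<nu> powr ((p - 1) / 2) * power_sum (p + 1) u" by blast
    define m where "m = square_sum u"
    from u(2) obtain n where "u n \<noteq> 0" by auto
    then have "0 < (norm (u n))\<^sup>2" by simp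
    also have "\<dots> \<le> m" unfolding m_def by (rule norm_square_le_infsum[OF u(1)])
    finally have m: "m > 0" .
    define \<theta> where "\<theta> = \<nu> / m"
    have \<theta>: "\<theta> > 0" using m \<nu> by (simp add: \<theta>_def)
    define w where "w = (\<lambda>n. complex_of_real (sqrt \<theta>) * u n)"
    have w: "square_summable w" unfolding w_def by (rule square_summable_scale[OF u(1)])
    have w_mass: "square_sum w = \<nu>"
      unfolding w_def square_sum_scale using \<theta> m by (simp add: \<theta>_def flip: m_def)
    have "\<nu> powr ((p - 1) / 2) = m powr ((p - 1) / 2) * \<theta> powr ((p - 1) / 2)"
      using m \<nu> by (simp add: \<theta>_def flip: powr_mult)
    then have "m powr ((p - 1) / 2) * energy J u
        < m powr ((p - 1) / 2) * (2 / (p + 1) * \<theta> powr ((p - 1) / 2) * power_sum (p + 1) u)"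
      using u(3) by (simp add: mult_ac flip: m_def)
    then have less: "energy J u < 2 / (p + 1) * \<theta> powr ((p - 1) / 2) * power_sum (p + 1) u"
      by (rule mult_left_less_imp_less) simp
    have "energy_functional p J w = \<theta> * energy J u / 2 - sqrt \<theta> powr (p + 1) * power_sum (p + 1) u / (p + 1)"
      using \<theta> by (simp add: energy_functional_def w_def energy_scale power_sum_scale)
    also have "sqrt \<theta> powr (p + 1) = \<theta> powr ((p + 1) / 2)"
      using \<theta> by (simp add: powr_half_sqrt[symmetric] powr_powr)
    also have "\<theta> powr ((p + 1) / 2) = \<theta> * \<theta> powr ((p - 1) / 2)"
      using \<theta> powr_add[of \<theta> 1 "(p - 1) / 2"]
      by (simp add: add_divide_distrib diff_divide_distrib add.commute)
    also have "\<theta> * energy J u / 2 - \<theta> * \<theta> powr ((p - 1) / 2) * power_sum (p + 1) u / (p + 1)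
        = \<theta> / 2 * (energy J u - 2 / (p + 1) * \<theta> powr ((p - 1) / 2) * power_sum (p + 1) u)"
      by (simp add: right_diff_distrib)
    also have "\<dots> < 0" using less \<theta> by (simp add: mult_pos_neg)
    finally have w_neg: "energy_functional p J w < 0" .
    obtain v where v: "square_summable v" "square_sum v = \<nu>"
      "\<And>u. square_summable u \<Longrightarrow> square_sum u = \<nu> \<Longrightarrow> energy_functional p J v \<le> energy_functional p J u"
      using energy_functional_has_minimizer[OF J p \<nu> w w_mass w_neg] by blast
    have "hamiltonian p J v = ground_energy p J \<nu>"
      unfolding ground_energy_def
      by (rule cInf_eq_minimum[symmetric])
        (use v J p in \<open>auto simp: lp_space_2_iff mass_eq_square_sum hamiltonian_eq\<close>)
    then have "is_minimizer p J \<nu> v"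
      using v by (simp add: is_minimizer_def lp_space_2_iff mass_eq_square_sum)
    then show ?thesis by blast
  qed
  \<comment> \<open>The threshold vanishes because \<open>0 powr x = 0\<close>.\<close>
  ultimately show ?thesis by (simp add: threshold_mass_def)
qed

end
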